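(* Let $k$ be a field and $Q$ a finite acyclic quiver with vertex set $Q_0$. The $k$-algebra $\mathcal{B}_Q$ is finite dimensional. Hence the monoid $\pi_Q$ is finite.
   Context: $\mathcal{B}_Q$ is the unital associative $k$-algebra with generators $X_t$ ($t\in Q_0$) and relations $X_s^2=X_s$ for all $s$; $X_sX_tX_s=X_tX_sX_t$ for all $s,t$; $X_tX_sX_t=X_sX_t$ whenever there is no arrow from $t$ to $s$ in $Q$. For $t\in Q_0$, $\mathsf{P}_t$ is the endofunctor of the category of finite dimensional $Q$-representations over $k$ sending $V$ to $V/\mathsf{t}_{S_t}(V)$, where $\mathsf{t}_{S_t}(V)$ is the greatest submodule of $V$ isomorphic to a direct sum of copies of the simple representation $S_t$ at $t$. $\pi_Q$ is the monoid of natural isomorphism classes of finite compositions of functors $\mathsf{P}_t$, $t\in Q_0$ (including the identity), under composition. *)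

theory Defs
  imports
    "Graph_Theory.Graph_Theory"
    "Jordan_Normal_Form.Missing_VectorSpace"
    "HOL-Algebra.QuotRing"
begin

text \<open>
  A quiver is a directed multigraph \<open>Q\<close> in the sense of \<^typ>\<open>('v, 'e) pre_digraph\<close>: an arrow
  \<open>e\<close> goes from \<open>tail Q e\<close> to \<open>head Q e\<close>; loops and parallel arrows are not excluded a priori.
  Vector spaces are \<^typ>\<open>('k, 'a) module\<close> records, whose ring multiplication and unit are
  irrelevant unless the space is an algebra.
\<close>

definition fin_dim_space :: "('k, 'r) ring_scheme \<Rightarrow> ('k, 'a, 'm) module_scheme \<Rightarrow> bool" where
  "fin_dim_space K V \<longleftrightarrow> vectorspace K V \<and> vectorspace.fin_dim K V"


section \<open>Algebras given by generators and relations\<close>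

text \<open>The free unital associative algebra on \<open>X\<close>: finitely supported functions on words in \<open>X\<close>,
  multiplied by convolution with respect to concatenation.\<close>

definition free_algebra :: "('k, 'r) ring_scheme \<Rightarrow> 'v set \<Rightarrow> ('k, 'v list \<Rightarrow> 'k) module" where
  "free_algebra K X = \<lparr>
     carrier = {f. (\<forall>w. f w \<in> carrier K) \<and> finite {w. f w \<noteq> \<zero>\<^bsub>K\<^esub>} \<and> {w. f w \<noteq> \<zero>\<^bsub>K\<^esub>} \<subseteq> lists X},
     mult = (\<lambda>f g w. \<Oplus>\<^bsub>K\<^esub>i\<in>{..length w}. f (take i w) \<otimes>\<^bsub>K\<^esub> g (drop i w)),
     one = (\<lambda>w. if w = [] then \<one>\<^bsub>K\<^esub> else \<zero>\<^bsub>K\<^esub>),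
     zero = (\<lambda>w. \<zero>\<^bsub>K\<^esub>),
     add = (\<lambda>f g w. f w \<oplus>\<^bsub>K\<^esub> g w),
     smult = (\<lambda>a f w. a \<otimes>\<^bsub>K\<^esub> f w)\<rparr>"

definition free_gen :: "('k, 'r) ring_scheme \<Rightarrow> 'v \<Rightarrow> 'v list \<Rightarrow> 'k" where
  "free_gen K t = (\<lambda>w. if w = [t] then \<one>\<^bsub>K\<^esub> else \<zero>\<^bsub>K\<^esub>)"

text \<open>Scalar multiplication on cosets: \<open>a \<cdot> (U + x) = U + a \<cdot> x\<close>.\<close>

definition coset_smult ::
    "('k, 'a, 'm) module_scheme \<Rightarrow> 'a set \<Rightarrow> 'k \<Rightarrow> 'a set \<Rightarrow> 'a set" where
  "coset_smult M U a C = (\<Union>x\<in>C. U +>\<^bsub>M\<^esub> (a \<odot>\<^bsub>M\<^esub> x))"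

definition quotient_algebra :: "('k, 'a, 'm) module_scheme \<Rightarrow> 'a set \<Rightarrow> ('k, 'a set) module" where
  "quotient_algebra A I = ring.extend (A Quot I) (module.fields (coset_smult A I))"

text \<open>A relation \<open>l = r\<close> is a pair \<open>(l, r)\<close>.  Ideals of \<^theory>\<open>HOL-Algebra.Ideal\<close> are two-sided.\<close>

definition presented_algebra ::
    "('k, 'r) ring_scheme \<Rightarrow> 'v set \<Rightarrow> (('v list \<Rightarrow> 'k) \<times> ('v list \<Rightarrow> 'k)) set
      \<Rightarrow> ('k, ('v list \<Rightarrow> 'k) set) module" where
  "presented_algebra K X R =
     (let A = free_algebra K X in quotient_algebra A (genideal A {l \<ominus>\<^bsub>A\<^esub> r | l r. (l, r) \<in> R}))"

definition B_relations ::
    "('k, 'r) ring_scheme \<Rightarrow> ('v, 'e) pre_digraph \<Rightarrow> (('v list \<Rightarrow> 'k) \<times> ('v list \<Rightarrow> 'k)) set" where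
  "B_relations K Q =
     (let A = free_algebra K (verts Q); X = free_gen K in
        {(X s \<otimes>\<^bsub>A\<^esub> X s, X s) | s. s \<in> verts Q}
      \<union> {(X s \<otimes>\<^bsub>A\<^esub> X t \<otimes>\<^bsub>A\<^esub> X s, X t \<otimes>\<^bsub>A\<^esub> X s \<otimes>\<^bsub>A\<^esub> X t) | s t. s \<in> verts Q \<and> t \<in> verts Q}
      \<union> {(X t \<otimes>\<^bsub>A\<^esub> X s \<otimes>\<^bsub>A\<^esub> X t, X s \<otimes>\<^bsub>A\<^esub> X t) | s t.
            s \<in> verts Q \<and> t \<in> verts Q \<and> \<not> t \<rightarrow>\<^bsub>Q\<^esub> s})"

definition B_algebra ::
    "('k, 'r) ring_scheme \<Rightarrow> ('v, 'e) pre_digraph \<Rightarrow> ('k, ('v list \<Rightarrow> 'k) set) module" where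
  "B_algebra K Q = presented_algebra K (verts Q) (B_relations K Q)"


section \<open>Quiver representations\<close>

record ('k, 'v, 'e, 'a) quiver_rep =
  space :: "'v \<Rightarrow> ('k, 'a) module"
  arrow_map :: "'e \<Rightarrow> 'a \<Rightarrow> 'a"

definition fin_dim_rep ::
    "('k, 'r) ring_scheme \<Rightarrow> ('v, 'e) pre_digraph \<Rightarrow> ('k, 'v, 'e, 'a) quiver_rep \<Rightarrow> bool" where
  "fin_dim_rep K Q V \<longleftrightarrow>
     (\<forall>s\<in>verts Q. fin_dim_space K (space V s)) \<and>
     (\<forall>e\<in>arcs Q. arrow_map V e \<in> module_hom K (space V (tail Q e)) (space V (head Q e)))"

text \<open>Morphisms are made extensional, so that equality of morphisms is HOL equality.\<close>

definition rep_hom ::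
    "('k, 'r) ring_scheme \<Rightarrow> ('v, 'e) pre_digraph \<Rightarrow> ('k, 'v, 'e, 'a) quiver_rep
      \<Rightarrow> ('k, 'v, 'e, 'b) quiver_rep \<Rightarrow> ('v \<Rightarrow> 'a \<Rightarrow> 'b) set" where
  "rep_hom K Q V W = {f \<in> extensional (verts Q).
     (\<forall>s\<in>verts Q. f s \<in> extensional (carrier (space V s)) \<and>
        f s \<in> module_hom K (space V s) (space W s)) \<and>
     (\<forall>e\<in>arcs Q. \<forall>x\<in>carrier (space V (tail Q e)).
        f (head Q e) (arrow_map V e x) = arrow_map W e (f (tail Q e) x))}"

definition rep_isomorphic ::
    "('k, 'r) ring_scheme \<Rightarrow> ('v, 'e) pre_digraph \<Rightarrow> ('k, 'v, 'e, 'a) quiver_rep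
      \<Rightarrow> ('k, 'v, 'e, 'b) quiver_rep \<Rightarrow> bool" where
  "rep_isomorphic K Q V W \<longleftrightarrow> (\<exists>f\<in>rep_hom K Q V W. \<forall>s\<in>verts Q.
     bij_betw (f s) (carrier (space V s)) (carrier (space W s)))"

text \<open>The simple representation at \<open>t\<close> has \<open>K\<close> at \<open>t\<close>, the zero space elsewhere, and zero maps.\<close>

definition simple_rep :: "('k, 'r) ring_scheme \<Rightarrow> 'v \<Rightarrow> ('k, 'v, 'e, 'k) quiver_rep" where
  "simple_rep K t = \<lparr>
     space = (\<lambda>s. \<lparr>carrier = (if s = t then carrier K else {\<zero>\<^bsub>K\<^esub>}), mult = mult K, one = one K,
                   zero = zero K, add = add K, smult = mult K\<rparr>),
     arrow_map = (\<lambda>e x. \<zero>\<^bsub>K\<^esub>)\<rparr>"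

definition space_power :: "nat \<Rightarrow> ('k, 'a) module \<Rightarrow> ('k, nat \<Rightarrow> 'a) module" where
  "space_power n M = \<lparr>
     carrier = {..<n} \<rightarrow>\<^sub>E carrier M,
     mult = (\<lambda>x y. \<lambda>i\<in>{..<n}. x i \<otimes>\<^bsub>M\<^esub> y i),
     one = (\<lambda>i\<in>{..<n}. \<one>\<^bsub>M\<^esub>),
     zero = (\<lambda>i\<in>{..<n}. \<zero>\<^bsub>M\<^esub>),
     add = (\<lambda>x y. \<lambda>i\<in>{..<n}. x i \<oplus>\<^bsub>M\<^esub> y i),
     smult = (\<lambda>a x. \<lambda>i\<in>{..<n}. a \<odot>\<^bsub>M\<^esub> x i)\<rparr>"

text \<open>The direct sum of \<open>n\<close> copies of \<open>V\<close>.\<close>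

definition rep_power :: "nat \<Rightarrow> ('k, 'v, 'e, 'a) quiver_rep \<Rightarrow> ('k, 'v, 'e, nat \<Rightarrow> 'a) quiver_rep" where
  "rep_power n V = \<lparr>
     space = (\<lambda>s. space_power n (space V s)),
     arrow_map = (\<lambda>e x. \<lambda>i\<in>{..<n}. arrow_map V e (x i))\<rparr>"

text \<open>A subrepresentation is given by its carriers; these are set to \<open>{}\<close> off the vertices, so that
  the pointwise order on functions is inclusion of subrepresentations.\<close>

definition subrep ::
    "('k, 'r) ring_scheme \<Rightarrow> ('v, 'e) pre_digraph \<Rightarrow> ('k, 'v, 'e, 'a) quiver_rep
      \<Rightarrow> ('v \<Rightarrow> 'a set) \<Rightarrow> bool" where
  "subrep K Q V U \<longleftrightarrow>
     (\<forall>s\<in>verts Q. subspace K (U s) (space V s)) \<and> (\<forall>s. s \<notin> verts Q \<longrightarrow> U s = {}) \<and>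
     (\<forall>e\<in>arcs Q. arrow_map V e ` U (tail Q e) \<subseteq> U (head Q e))"

definition restrict_rep ::
    "('k, 'v, 'e, 'a) quiver_rep \<Rightarrow> ('v \<Rightarrow> 'a set) \<Rightarrow> ('k, 'v, 'e, 'a) quiver_rep" where
  "restrict_rep V U = V\<lparr>space := (\<lambda>s. (space V s)\<lparr>carrier := U s\<rparr>)\<rparr>"

text \<open>The greatest subrepresentation of \<open>V\<close> isomorphic to a direct sum of copies of the simple
  representation at \<open>t\<close>.  Finitely many copies suffice, as \<open>V\<close> is finite dimensional.\<close>

definition torsion ::
    "('k, 'r) ring_scheme \<Rightarrow> ('v, 'e) pre_digraph \<Rightarrow> 'v \<Rightarrow> ('k, 'v, 'e, 'a) quiver_rep
      \<Rightarrow> 'v \<Rightarrow> 'a set" where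
  "torsion K Q t V = (GREATEST U. subrep K Q V U \<and>
     (\<exists>n. rep_isomorphic K Q (restrict_rep V U) (rep_power n (simple_rep K t))))"

definition quotient_space :: "('k, 'a) module \<Rightarrow> 'a set \<Rightarrow> ('k, 'a set) module" where
  "quotient_space M U = \<lparr>
     carrier = a_rcosets\<^bsub>M\<^esub> U,
     mult = (\<lambda>C D. U), one = U,
     zero = U,
     add = set_add M,
     smult = coset_smult M U\<rparr>"

definition quotient_rep ::
    "('v, 'e) pre_digraph \<Rightarrow> ('k, 'v, 'e, 'a) quiver_rep \<Rightarrow> ('v \<Rightarrow> 'a set)
      \<Rightarrow> ('k, 'v, 'e, 'a set) quiver_rep" where
  "quotient_rep Q V U = \<lparr>
     space = (\<lambda>s. quotient_space (space V s) (U s)),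
     arrow_map = (\<lambda>e C. \<Union>x\<in>C. U (head Q e) +>\<^bsub>space V (head Q e)\<^esub> arrow_map V e x)\<rparr>"

text \<open>Transport of structure along a map that is injective on the carriers.\<close>

definition transport_space :: "('a \<Rightarrow> 'b) \<Rightarrow> ('k, 'a) module \<Rightarrow> ('k, 'b) module" where
  "transport_space h M = (let g = inv_into (carrier M) h in \<lparr>
     carrier = h ` carrier M,
     mult = (\<lambda>x y. h (g x \<otimes>\<^bsub>M\<^esub> g y)),
     one = h \<one>\<^bsub>M\<^esub>,
     zero = h \<zero>\<^bsub>M\<^esub>,
     add = (\<lambda>x y. h (g x \<oplus>\<^bsub>M\<^esub> g y)),
     smult = (\<lambda>a x. h (a \<odot>\<^bsub>M\<^esub> g x))\<rparr>)"

definition transport_rep ::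
    "('a \<Rightarrow> 'b) \<Rightarrow> ('v, 'e) pre_digraph \<Rightarrow> ('k, 'v, 'e, 'a) quiver_rep
      \<Rightarrow> ('k, 'v, 'e, 'b) quiver_rep" where
  "transport_rep h Q V = \<lparr>
     space = (\<lambda>s. transport_space h (space V s)),
     arrow_map = (\<lambda>e x. h (arrow_map V e (inv_into (carrier (space V (tail Q e))) h x)))\<rparr>"


section \<open>Categories and endofunctors\<close>

text \<open>\<open>Comp C U V W g f\<close> is the composite of \<open>f : U \<rightarrow> V\<close> and \<open>g : V \<rightarrow> W\<close>.\<close>

record ('o, 'm) category =
  Obj :: "'o set"
  Hom :: "'o \<Rightarrow> 'o \<Rightarrow> 'm set"
  Ident :: "'o \<Rightarrow> 'm"
  Comp :: "'o \<Rightarrow> 'o \<Rightarrow> 'o \<Rightarrow> 'm \<Rightarrow> 'm \<Rightarrow> 'm"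

text \<open>\<open>mor_map F V W f\<close> is the value of \<open>F\<close> on the morphism \<open>f : V \<rightarrow> W\<close>.\<close>

record ('o, 'm) endofunctor =
  obj_map :: "'o \<Rightarrow> 'o"
  mor_map :: "'o \<Rightarrow> 'o \<Rightarrow> 'm \<Rightarrow> 'm"

definition identity_functor :: "('o, 'm) endofunctor" where
  "identity_functor = \<lparr>obj_map = (\<lambda>V. V), mor_map = (\<lambda>V W f. f)\<rparr>"

definition functor_comp ::
    "('o, 'm) endofunctor \<Rightarrow> ('o, 'm) endofunctor \<Rightarrow> ('o, 'm) endofunctor"
    (infixr \<open>\<circ>\<^sub>F\<close> 55) where
  "F \<circ>\<^sub>F G = \<lparr>
     obj_map = (\<lambda>V. obj_map F (obj_map G V)),
     mor_map = (\<lambda>V W f. mor_map F (obj_map G V) (obj_map G W) (mor_map G V W f))\<rparr>"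

definition iso_in :: "('o, 'm) category \<Rightarrow> 'o \<Rightarrow> 'o \<Rightarrow> 'm \<Rightarrow> bool" where
  "iso_in C V W f \<longleftrightarrow> f \<in> Hom C V W \<and>
     (\<exists>g\<in>Hom C W V. Comp C V W V g f = Ident C V \<and> Comp C W V W f g = Ident C W)"

definition naturally_isomorphic ::
    "('o, 'm) category \<Rightarrow> ('o, 'm) endofunctor \<Rightarrow> ('o, 'm) endofunctor \<Rightarrow> bool" where
  "naturally_isomorphic C F G \<longleftrightarrow> (\<exists>\<eta>.
     (\<forall>V\<in>Obj C. iso_in C (obj_map F V) (obj_map G V) (\<eta> V)) \<and>
     (\<forall>V\<in>Obj C. \<forall>W\<in>Obj C. \<forall>f\<in>Hom C V W.
        Comp C (obj_map F V) (obj_map F W) (obj_map G W) (\<eta> W) (mor_map F V W f)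
      = Comp C (obj_map F V) (obj_map G V) (obj_map G W) (mor_map G V W f) (\<eta> V)))"

text \<open>The category of finite dimensional representations whose vectors are of type \<open>'a\<close>.  If \<open>'a\<close> is
  large enough (e.g. \<open>'k list\<close>), every finite dimensional representation is isomorphic to one in it.\<close>

definition rep_category ::
    "('k, 'r) ring_scheme \<Rightarrow> ('v, 'e) pre_digraph
      \<Rightarrow> (('k, 'v, 'e, 'a) quiver_rep, 'v \<Rightarrow> 'a \<Rightarrow> 'a) category" where
  "rep_category K Q = \<lparr>
     Obj = {V. fin_dim_rep K Q V},
     Hom = rep_hom K Q,
     Ident = (\<lambda>V. \<lambda>s\<in>verts Q. \<lambda>x\<in>carrier (space V s). x),
     Comp = (\<lambda>U V W g f. \<lambda>s\<in>verts Q. compose (carrier (space U s)) (g s) (f s))\<rparr>"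


section \<open>Projection functors\<close>

text \<open>The quotient of \<open>V\<close> has cosets, of type \<open>'a set\<close>, as its vectors.  To obtain an endofunctor, it
  is copied back to type \<open>'a\<close> by replacing each coset by a chosen element of it.\<close>

definition pick :: "'a set \<Rightarrow> 'a" where
  "pick C = (SOME x. x \<in> C)"

definition projection_functor ::
    "('k, 'r) ring_scheme \<Rightarrow> ('v, 'e) pre_digraph \<Rightarrow> 'v
      \<Rightarrow> (('k, 'v, 'e, 'a) quiver_rep, 'v \<Rightarrow> 'a \<Rightarrow> 'a) endofunctor" where
  "projection_functor K Q t =
     (let quot = (\<lambda>V. quotient_rep Q V (torsion K Q t V)) in \<lparr>
        obj_map = (\<lambda>V. transport_rep pick Q (quot V)),
        mor_map = (\<lambda>V W f. \<lambda>s\<in>verts Q. \<lambda>y\<in>pick ` carrier (space (quot V) s).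
          pick (\<Union>x\<in>inv_into (carrier (space (quot V) s)) pick y.
            torsion K Q t W s +>\<^bsub>space W s\<^esub> f s x))\<rparr>)"

definition projection_composites ::
    "('k, 'r) ring_scheme \<Rightarrow> ('v, 'e) pre_digraph
      \<Rightarrow> (('k, 'v, 'e, 'a) quiver_rep, 'v \<Rightarrow> 'a \<Rightarrow> 'a) endofunctor set" where
  "projection_composites K Q =
     {foldr (\<lambda>t F. projection_functor K Q t \<circ>\<^sub>F F) ts identity_functor | ts. ts \<in> lists (verts Q)}"

definition projection_class ::
    "('k, 'r) ring_scheme \<Rightarrow> ('v, 'e) pre_digraph
      \<Rightarrow> (('k, 'v, 'e, 'a) quiver_rep, 'v \<Rightarrow> 'a \<Rightarrow> 'a) endofunctor
      \<Rightarrow> (('k, 'v, 'e, 'a) quiver_rep, 'v \<Rightarrow> 'a \<Rightarrow> 'a) endofunctor set" where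
  "projection_class K Q F =
     {G \<in> projection_composites K Q. naturally_isomorphic (rep_category K Q) F G}"

definition projection_monoid ::
    "('k, 'r) ring_scheme \<Rightarrow> ('v, 'e) pre_digraph
      \<Rightarrow> (('k, 'v, 'e, 'a) quiver_rep, 'v \<Rightarrow> 'a \<Rightarrow> 'a) endofunctor set monoid" where
  "projection_monoid K Q = \<lparr>
     carrier = projection_class K Q ` projection_composites K Q,
     mult = (\<lambda>A B. \<Union>F\<in>A. \<Union>G\<in>B. projection_class K Q (F \<circ>\<^sub>F G)),
     one = projection_class K Q identity_functor\<rparr>"

end

(*
  Everything rests on one reduction of words.  If m receives no arrow from the other vertices of a
  set Y, then the braid relation and the third relation give X_m X_t X_m = X_m X_t for t in Y, so in
  a word over Y all occurrences of m after the first can be deleted.  Removing such sources one by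
  one (the quiver is acyclic) leaves finitely many words.  Hence B_Q is spanned by finitely many
  monomials.

  For the functors, P_{t_1} ... P_{t_n} V is the quotient of V by a subrepresentation obtained from 0
  by applying the operators "replace U_t by the vectors of V_t that all arrows out of t map into U",
  first for t_n, last for t_1.  These operators satisfy the same two relations, so only finitely many
  of their composites are different, and composites of projection functors with equal kernels are
  naturally isomorphic.
*)

theory Submission imports Defs begin

section \<open>Words with absorbed letters\<close>

text \<open>The word argument is carried out once, for an arbitrary map \<open>\<phi>\<close> on
  words whose value on a concatenation is determined by the values on the two parts. It is applied
  to cosets of monomials and to operators on families of subspaces, so the functor monoid is treated
  without letting B_Q act on functors. The difficulty on the functor side is that composites with
  the same effect need not be equal: at each stage cosets are replaced by chosen elements, and
  different words may lead to different choices. Kernels are families of subsets of the original V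
  and do not depend on these choices, so identities between kernel operators are honest equalities.
  Each composite is therefore carried together with a natural surjection from V; two surjections
  with the same kernel have canonically isomorphic targets. The operators become explicit because
  the greatest sum of copies of S_t inside V consists of the vectors of V_t killed by all arrows out
  of t. The absence of loops enters there and in the idempotence of the operators.\<close>

lemma finite_image_lists_absorb:
  fixes \<phi> :: "'v list \<Rightarrow> 'c"
  assumes "finite X"
    and hom: "\<And>u v. u \<in> lists X \<Longrightarrow> v \<in> lists X \<Longrightarrow> \<phi> (u @ v) = g (\<phi> u) (\<phi> v)"
    and idem: "\<And>s. s \<in> X \<Longrightarrow> \<phi> [s, s] = \<phi> [s]"
    and absorb: "\<And>s t. s \<in> X \<Longrightarrow> t \<in> X \<Longrightarrow> s \<noteq> t \<Longrightarrow> \<not> R t s \<Longrightarrow> \<phi> [s, t, s] = \<phi> [s, t]"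
    and source: "\<And>Y. Y \<subseteq> X \<Longrightarrow> Y \<noteq> {} \<Longrightarrow> \<exists>m\<in>Y. \<forall>t\<in>Y. \<not> R t m"
  shows "finite (\<phi> ` lists X)"
proof -
  \<comment> \<open>By \<open>hom\<close>, having equal values is a congruence for concatenation, so
    words with equal values may be exchanged inside longer words.\<close>
  have congs: "\<phi> (u @ y) = \<phi> (v @ y)" "\<phi> (y @ u) = \<phi> (y @ v)"
    if "\<phi> u = \<phi> v" "u \<in> lists X" "v \<in> lists X" "y \<in> lists X" for y u v
    using that(1) hom[OF that(2,4)] hom[OF that(3,4)] hom[OF that(4,2)] hom[OF that(4,3)]
    by simp_all
  have "finite (\<phi> ` lists Y)" if "Y \<subseteq> X" "finite Y" for Y
    using that(2,1)
  proof (induction Y rule: finite_psubset_induct)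
    case (psubset Y)
    show ?case
    proof (cases "Y = {}")
      case False
      then obtain m where m: "m \<in> Y" and src: "\<And>t. t \<in> Y \<Longrightarrow> \<not> R t m"
        using source[OF psubset.prems False] by auto
      have X: "m \<in> X" "lists Y \<subseteq> lists X"
        using m psubset.prems by (auto simp: in_lists_conv_set)
      let ?Z = "Y - {m}"
      have fin: "finite (\<phi> ` lists ?Z)"
        by (rule psubset.IH) (use m psubset.prems in auto)
      have snoc_m: "\<phi> (m # u @ [m]) = \<phi> (m # u)" if "u \<in> lists ?Z" for u
        using that
      proof (induction u rule: rev_induct)
        case Nil
        then show ?case by (simp add: idem X)
      next
        case (snoc x u)
        then have x: "x \<in> Y" "x \<in> X" "x \<noteq> m" and u: "u \<in> lists ?Z" "u \<in> lists X"
          using psubset.prems by (auto simp: in_lists_conv_set)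
        have IH: "\<phi> (m # u @ [m]) = \<phi> (m # u)"
          using snoc.IH[OF u(1)] .
        \<comment> \<open>Absorption acts on m x m only, so an m is needed in front of x. The
          induction hypothesis, read backwards, supplies it, and read forwards removes it
          again.\<close>
        have "\<phi> ((m # u) @ [x, m]) = \<phi> ((m # u @ [m]) @ [x, m])"
          by (rule congs(1)) (use IH x u X in auto)
        also have "\<dots> = \<phi> ((m # u) @ [m, x, m])"
          by simp
        also have "\<dots> = \<phi> ((m # u) @ [m, x])"
          by (rule congs(2)[OF absorb]) (use x u X src in auto)
        also have "\<dots> = \<phi> ((m # u @ [m]) @ [x])"
          by simp
        also have "\<dots> = \<phi> ((m # u) @ [x])"
          by (rule congs(1)) (use IH x u X in auto)
        finally show ?case by simp
      qed
      have filt: "\<phi> (m # v) = \<phi> (m # filter (\<lambda>x. x \<noteq> m) v)" if "v \<in> lists Y" for v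
        using that
      proof (induction v rule: rev_induct)
        case (snoc x v)
        let ?f = "filter (\<lambda>x. x \<noteq> m) v"
        have f: "?f \<in> lists ?Z" "v \<in> lists X" "?f \<in> lists X" "x \<in> X"
          using snoc.prems psubset.prems by auto
        have "\<phi> ((m # v) @ [x]) = \<phi> ((m # ?f) @ [x])"
          using snoc.IH snoc.prems f X by (intro congs(1)) auto
        then show ?case
          using snoc_m[OF f(1)] by (cases "x = m") simp_all
      qed simp
      \<comment> \<open>Splitting at the first m puts the prefix into \<open>lists ?Z\<close>, and
        all later occurrences of m are deleted by \<open>filt\<close>. A value over Y is thus a
        value over \<open>?Z\<close> or is computed from a pair of such values.\<close>
      have "\<phi> ` lists Y \<subseteq> \<phi> ` lists ?Z \<union> (\<lambda>(a, b). g a (g (\<phi> [m]) b)) ` (\<phi> ` lists ?Z \<times> \<phi> ` lists ?Z)"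
      proof
        fix a assume "a \<in> \<phi> ` lists Y"
        then obtain w where w: "w \<in> lists Y" "a = \<phi> w" by auto
        show "a \<in> \<phi> ` lists ?Z \<union> (\<lambda>(a, b). g a (g (\<phi> [m]) b)) ` (\<phi> ` lists ?Z \<times> \<phi> ` lists ?Z)"
        proof (cases "m \<in> set w")
          case True
          then obtain u v where uv: "w = u @ m # v" "m \<notin> set u"
            by (meson split_list_first)
          let ?f = "filter (\<lambda>x. x \<noteq> m) v"
          have u: "u \<in> lists ?Z" "u \<in> lists X" and v: "v \<in> lists Y" "v \<in> lists X"
            and f: "?f \<in> lists ?Z" "?f \<in> lists X"
            using w uv psubset.prems by auto
          have "a = \<phi> (u @ (m # v))" by (simp add: w uv)
          also have "\<dots> = \<phi> (u @ (m # ?f))"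
            by (rule congs(2)[OF filt]) (use u v f X in auto)
          also have "\<dots> = g (\<phi> u) (\<phi> ([m] @ ?f))"
            by (subst hom) (use u f X in auto)
          also have "\<dots> = g (\<phi> u) (g (\<phi> [m]) (\<phi> ?f))"
            by (subst hom) (use u f X in auto)
          finally show ?thesis using u(1) f(1) by auto
        next
          case False
          then have "w \<in> lists ?Z" using w by auto
          then show ?thesis using w by auto
        qed
      qed
      then show ?thesis
        by (rule finite_subset) (use fin in auto)
    qed simp
  qed
  then show ?thesis using assms(1) by blast
qed

section \<open>Sources and loops in acyclic quivers\<close>

lemma (in wf_digraph) acyclic_arcs_ends:
  assumes "\<nexists>p. cycle p"
  shows "acyclic (arcs_ends G)"
proof (rule acyclicI, rule allI, rule notI)
  fix x assume "(x, x) \<in> (arcs_ends G)\<^sup>+"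
  then have "x \<rightarrow>\<^sup>+ x" by simp
  then obtain p where "awalk x p x" "p \<noteq> []"
    using reachable1_awalk by blast
  then have "closed_w p" by (auto simp: closed_w_def)
  with closed_w_imp_cycle assms show False by blast
qed

text \<open>With finitely many arcs and no cycles the arrow relation is well founded; the source is
  a minimal element of Y.\<close>

lemma (in fin_digraph) source_exists:
  assumes "\<nexists>p. cycle p" "Y \<subseteq> verts G" "Y \<noteq> {}"
  shows "\<exists>m\<in>Y. \<forall>t\<in>Y. \<not> t \<rightarrow> m"
proof -
  have "finite (arcs_ends G)" by (simp add: arcs_ends_def)
  then have "wf (arcs_ends G)"
    using acyclic_arcs_ends[OF assms(1)] by (rule finite_acyclic_wf)
  moreover obtain y where "y \<in> Y"
    using assms(3) by blast
  ultimately obtain m where "m \<in> Y" "\<And>t. (t, m) \<in> arcs_ends G \<Longrightarrow> t \<notin> Y"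
    by (rule wfE_min) blast
  then show ?thesis by blast
qed

lemma (in wf_digraph) no_loop:
  assumes "\<nexists>p. cycle p" "e \<in> arcs G"
  shows "tail G e \<noteq> head G e"
proof
  assume "tail G e = head G e"
  then have "(tail G e, tail G e) \<in> arcs_ends G"
    using in_arcs_imp_in_arcs_ends[OF assms(2)] by simp
  then show False
    using acyclic_arcs_ends[OF assms(1)] by (auto simp: acyclic_def)
qed

section \<open>Images of vector spaces\<close>

text \<open>N is a bare record at this point, and \<open>module_hom\<close> asks only for
  compatibility with addition and scalars. Equational axioms pass along the surjection, and
  negatives are images of negatives. The zero gets a hypothesis of its own, since its preservation
  cannot be deduced before N is known to be a group. Coset spaces receive their vector space
  structure in this way.\<close>

lemma vectorspace_linear_image:
  fixes p :: "'a \<Rightarrow> 'b"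
  assumes "vectorspace K M" and p: "p \<in> module_hom K M N"
    and surj: "p ` carrier M = carrier N" and zero: "p \<zero>\<^bsub>M\<^esub> = \<zero>\<^bsub>N\<^esub>"
  shows "vectorspace K N"
proof -
  interpret M: vectorspace K M by fact
  have add: "p x \<oplus>\<^bsub>N\<^esub> p y = p (x \<oplus>\<^bsub>M\<^esub> y)" if "x \<in> carrier M" "y \<in> carrier M" for x y
    using module_hom_add[OF p] that by simp
  have sm: "a \<odot>\<^bsub>N\<^esub> p x = p (a \<odot>\<^bsub>M\<^esub> x)" if "a \<in> carrier K" "x \<in> carrier M" for a x
    using module_hom_smult[OF p] that by simp
  have all: "(\<forall>y\<in>carrier N. P y) \<longleftrightarrow> (\<forall>x\<in>carrier M. P (p x))" for P
    unfolding surj[symmetric] by blast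
  have cl: "p x \<in> carrier N" if "x \<in> carrier M" for x
    using that surj by blast
  have neg: "\<exists>z\<in>carrier N. p x \<oplus>\<^bsub>N\<^esub> z = \<zero>\<^bsub>N\<^esub>" if "x \<in> carrier M" for x
    using that by (intro bexI[of _ "p (\<ominus>\<^bsub>M\<^esub> x)"]) (auto simp: add zero[symmetric] cl M.M.r_neg)
  show ?thesis
  proof (rule vs_criteria)
    show "\<forall>v\<in>carrier N. \<exists>neg_v\<in>carrier N. v \<oplus>\<^bsub>N\<^esub> neg_v = \<zero>\<^bsub>N\<^esub>"
      using neg by (simp add: all)
  next
    show "\<forall>v w. v \<in> carrier N \<and> w \<in> carrier N \<longrightarrow> v \<oplus>\<^bsub>N\<^esub> w = w \<oplus>\<^bsub>N\<^esub> v"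
      by (auto simp: add M.M.a_comm surj[symmetric])
  qed (auto simp: all add sm zero[symmetric] cl M.field_axioms
         M.M.a_assoc M.smult_assoc1 M.smult_l_distr M.smult_r_distr surj[symmetric])
qed

lemma fin_dim_space_linear_image:
  assumes M: "fin_dim_space K M" and p: "p \<in> module_hom K M N"
    and surj: "p ` carrier M = carrier N" and zero: "p \<zero>\<^bsub>M\<^esub> = \<zero>\<^bsub>N\<^esub>"
  shows "fin_dim_space K N"
proof -
  have N: "vectorspace K N"
    using vectorspace_linear_image[OF _ p surj zero] M by (simp add: fin_dim_space_def)
  interpret M: vectorspace K M
    using M by (simp add: fin_dim_space_def)
  interpret N: vectorspace K N by (fact N)
  interpret linear_map K M N p
    by unfold_locales (rule p)
  show ?thesis
    using M N surj_fin_dim[OF _ surj] by (simp add: fin_dim_space_def)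
qed


section \<open>The free algebra\<close>

definition monomial :: "('k, 'r) ring_scheme \<Rightarrow> 'v list \<Rightarrow> 'v list \<Rightarrow> 'k" where
  "monomial K w = (\<lambda>v. if v = w then \<one>\<^bsub>K\<^esub> else \<zero>\<^bsub>K\<^esub>)"

text \<open>Both sides sum \<open>F j k\<close> over all j + k \<le> n, by diagonals on the left and
  by columns on the right. Passing to \<open>Suc n\<close> adds one diagonal.\<close>

lemma (in abelian_monoid) finsum_triangle:
  fixes F :: "nat \<Rightarrow> nat \<Rightarrow> 'a"
  assumes F: "\<And>j k. F j k \<in> carrier G"
  shows "(\<Oplus>i\<in>{..n}. \<Oplus>j\<in>{..i}. F j (i - j)) = (\<Oplus>j\<in>{..n}. \<Oplus>k\<in>{..n - j}. F j k)"
proof (induction n)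
  case (Suc n)
  have "(\<Oplus>j\<in>{..Suc n}. \<Oplus>k\<in>{..Suc n - j}. F j k)
      = F (Suc n) 0 \<oplus> (\<Oplus>j\<in>{..n}. \<Oplus>k\<in>{..Suc n - j}. F j k)"
    by (simp add: F finsum_Suc)
  also have "(\<Oplus>j\<in>{..n}. \<Oplus>k\<in>{..Suc n - j}. F j k)
      = (\<Oplus>j\<in>{..n}. F j (Suc n - j) \<oplus> (\<Oplus>k\<in>{..n - j}. F j k))"
    by (rule finsum_cong') (auto simp: F finsum_Suc Suc_diff_le)
  also have "\<dots> = (\<Oplus>j\<in>{..n}. F j (Suc n - j)) \<oplus> (\<Oplus>j\<in>{..n}. \<Oplus>k\<in>{..n - j}. F j k)"
    by (rule finsum_addf) (auto simp: F)
  finally have "(\<Oplus>j\<in>{..Suc n}. \<Oplus>k\<in>{..Suc n - j}. F j k)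
      = F (Suc n) 0 \<oplus> ((\<Oplus>j\<in>{..n}. F j (Suc n - j)) \<oplus> (\<Oplus>i\<in>{..n}. \<Oplus>j\<in>{..i}. F j (i - j)))"
    by (simp only: Suc.IH)
  also have "\<dots> = (\<Oplus>j\<in>{..Suc n}. F j (Suc n - j)) \<oplus> (\<Oplus>i\<in>{..n}. \<Oplus>j\<in>{..i}. F j (i - j))"
    by (simp add: F finsum_Suc a_assoc)
  also have "\<dots> = (\<Oplus>i\<in>{..Suc n}. \<Oplus>j\<in>{..i}. F j (i - j))"
    by (subst (2) finsum_Suc) (auto simp: F)
  finally show ?case by (rule sym)
qed (simp add: F)

lemma (in abelian_monoid) finsum_delta:
  assumes "finite A" "i \<in> A" "c \<in> carrier G"
  shows "(\<Oplus>j\<in>A. if j = i then c else \<zero>) = c"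
proof -
  have "(\<Oplus>j\<in>A. if i = j then c else \<zero>) = c"
    using assms by (intro finsum_singleton[of i A "\<lambda>_. c"]) auto
  then show ?thesis by (simp only: eq_commute)
qed

context ring
begin

lemma free_algebra_carrierD:
  "f \<in> carrier (free_algebra R X) \<Longrightarrow> f w \<in> carrier R"
  "f \<in> carrier (free_algebra R X) \<Longrightarrow> finite {w. f w \<noteq> \<zero>}"
  "f \<in> carrier (free_algebra R X) \<Longrightarrow> {w. f w \<noteq> \<zero>} \<subseteq> lists X"
  by (auto simp: free_algebra_def)

lemma free_algebra_carrierI:
  assumes "\<And>w. f w \<in> carrier R" "{w. f w \<noteq> \<zero>} \<subseteq> S" "finite S" "S \<subseteq> lists X"
  shows "f \<in> carrier (free_algebra R X)"
  using assms finite_subset[of "{w. f w \<noteq> \<zero>}" S] by (simp add: free_algebra_def subset_trans)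

text \<open>A nonzero coefficient at w needs a nonzero summand, which cuts w into a word from the
  support of f and one from the support of g. There are finitely many such concatenations.\<close>

lemma free_algebra_mult_closed:
  assumes f: "f \<in> carrier (free_algebra R X)" and g: "g \<in> carrier (free_algebra R X)"
  shows "f \<otimes>\<^bsub>free_algebra R X\<^esub> g \<in> carrier (free_algebra R X)"
proof -
  note D = free_algebra_carrierD[OF f] free_algebra_carrierD[OF g]
  let ?h = "\<lambda>w. \<Oplus>i\<in>{..length w}. f (take i w) \<otimes> g (drop i w)"
  let ?S = "(\<lambda>(u, v). u @ v) ` ({w. f w \<noteq> \<zero>} \<times> {w. g w \<noteq> \<zero>})"
  have "w \<in> ?S" if w: "?h w \<noteq> \<zero>" for w
  proof -
    have "\<exists>i. f (take i w) \<otimes> g (drop i w) \<noteq> \<zero>"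
      using w add.finprod_one_eqI[of "{..length w}" "\<lambda>i. f (take i w) \<otimes> g (drop i w)"] by metis
    then obtain i where i: "f (take i w) \<otimes> g (drop i w) \<noteq> \<zero>" ..
    have "f (take i w) \<noteq> \<zero>" "g (drop i w) \<noteq> \<zero>"
      using i D(1)[of "take i w"] D(4)[of "drop i w"] by auto
    then show ?thesis
      by (intro rev_image_eqI[of "(take i w, drop i w)"]) simp_all
  qed
  then have supp: "{w. ?h w \<noteq> \<zero>} \<subseteq> ?S" by blast
  have fin: "finite ?S" using D(2,5) by simp
  have words: "?S \<subseteq> lists X"
  proof
    fix w assume "w \<in> ?S"
    then obtain u v where "w = u @ v" "f u \<noteq> \<zero>" "g v \<noteq> \<zero>" by auto
    moreover have "u \<in> lists X" "v \<in> lists X"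
      using D(3,6) calculation(2,3) by blast+
    ultimately show "w \<in> lists X" by simp
  qed
  have "?h w \<in> carrier R" for w
    using D(1,4) by (intro finsum_closed) auto
  then have "?h \<in> carrier (free_algebra R X)"
    using supp fin words by (rule free_algebra_carrierI)
  then show ?thesis by (simp add: free_algebra_def)
qed

lemma monomial_closed: "w \<in> lists X \<Longrightarrow> monomial R w \<in> carrier (free_algebra R X)"
  by (rule free_algebra_carrierI[of _ "{w}"]) (auto simp: monomial_def)

lemma free_algebra_add_support:
  assumes f: "f \<in> carrier (free_algebra R X)" and g: "g \<in> carrier (free_algebra R X)"
  shows "{w. f w \<oplus> g w \<noteq> \<zero>} \<subseteq> {w. f w \<noteq> \<zero>} \<union> {w. g w \<noteq> \<zero>}"
  using free_algebra_carrierD[OF f] free_algebra_carrierD[OF g] by auto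

lemma free_algebra_abelian_group: "abelian_group (free_algebra R X)" (is "abelian_group ?A")
proof (rule abelian_groupI)
  fix f g assume f: "f \<in> carrier ?A" and g: "g \<in> carrier ?A"
  note D = free_algebra_carrierD[OF f] free_algebra_carrierD[OF g]
  show "f \<oplus>\<^bsub>?A\<^esub> g \<in> carrier ?A"
  proof (rule free_algebra_carrierI)
    show "{w. (f \<oplus>\<^bsub>?A\<^esub> g) w \<noteq> \<zero>} \<subseteq> {w. f w \<noteq> \<zero>} \<union> {w. g w \<noteq> \<zero>}"
      using free_algebra_add_support[OF f g] by (simp add: free_algebra_def)
  qed (use D in \<open>simp_all add: free_algebra_def\<close>)
  show "f \<oplus>\<^bsub>?A\<^esub> g = g \<oplus>\<^bsub>?A\<^esub> f"
    using D by (auto simp: free_algebra_def a_comm)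
  fix h assume "h \<in> carrier ?A"
  note D = D free_algebra_carrierD[OF this]
  show "f \<oplus>\<^bsub>?A\<^esub> g \<oplus>\<^bsub>?A\<^esub> h = f \<oplus>\<^bsub>?A\<^esub> (g \<oplus>\<^bsub>?A\<^esub> h)"
    using D by (auto simp: free_algebra_def a_assoc)
next
  fix f assume f: "f \<in> carrier ?A"
  note D = free_algebra_carrierD[OF f]
  show "\<zero>\<^bsub>?A\<^esub> \<oplus>\<^bsub>?A\<^esub> f = f"
    using D by (auto simp: free_algebra_def)
  have "(\<lambda>w. \<ominus> f w) \<in> carrier ?A"
    using D by (intro free_algebra_carrierI[of _ "{w. f w \<noteq> \<zero>}"]) auto
  then show "\<exists>g\<in>carrier ?A. g \<oplus>\<^bsub>?A\<^esub> f = \<zero>\<^bsub>?A\<^esub>"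
    using D by (intro bexI[of _ "\<lambda>w. \<ominus> f w"]) (simp_all add: free_algebra_def l_neg)
qed (simp add: free_algebra_def)

lemma free_algebra_mult_assoc:
  assumes f: "f \<in> carrier (free_algebra R X)" and g: "g \<in> carrier (free_algebra R X)"
    and h: "h \<in> carrier (free_algebra R X)"
  shows "f \<otimes>\<^bsub>free_algebra R X\<^esub> g \<otimes>\<^bsub>free_algebra R X\<^esub> h
    = f \<otimes>\<^bsub>free_algebra R X\<^esub> (g \<otimes>\<^bsub>free_algebra R X\<^esub> h)"
proof -
  note D = free_algebra_carrierD(1)[OF f] free_algebra_carrierD(1)[OF g] free_algebra_carrierD(1)[OF h]
  have "(\<Oplus>i\<in>{..length w}. (\<Oplus>j\<in>{..length (take i w)}. f (take j (take i w)) \<otimes> g (drop j (take i w))) \<otimes> h (drop i w))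
      = (\<Oplus>j\<in>{..length w}. f (take j w) \<otimes> (\<Oplus>k\<in>{..length (drop j w)}. g (take k (drop j w)) \<otimes> h (drop k (drop j w))))"
      (is "?l = ?r") for w
  proof -
    \<comment> \<open>Both sides run over all ways of cutting w into three consecutive words. Here j
      and k are the lengths of the first two; the outer index i on the left is j + k.\<close>
    define F where "F j k = f (take j w) \<otimes> (g (take k (drop j w)) \<otimes> h (drop k (drop j w)))" for j k
    have F: "F j k \<in> carrier R" for j k by (simp add: F_def D)
    have "?l = (\<Oplus>i\<in>{..length w}. \<Oplus>j\<in>{..i}. F j (i - j))"
    proof (rule finsum_cong')
      fix i assume i: "i \<in> {..length w}"
      have "(\<Oplus>j\<in>{..length (take i w)}. f (take j (take i w)) \<otimes> g (drop j (take i w))) \<otimes> h (drop i w)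
         = (\<Oplus>j\<in>{..length (take i w)}. f (take j (take i w)) \<otimes> g (drop j (take i w)) \<otimes> h (drop i w))"
        by (rule finsum_ldistr) (auto simp: D)
      also have "\<dots> = (\<Oplus>j\<in>{..i}. F j (i - j))"
        using i by (intro finsum_cong')
          (auto simp: F F_def D drop_take min_def m_assoc[symmetric])
      finally show "(\<Oplus>j\<in>{..length (take i w)}. f (take j (take i w)) \<otimes> g (drop j (take i w))) \<otimes> h (drop i w)
         = (\<Oplus>j\<in>{..i}. F j (i - j))" .
    qed (auto simp: F)
    also have "\<dots> = (\<Oplus>j\<in>{..length w}. \<Oplus>k\<in>{..length w - j}. F j k)"
      by (rule finsum_triangle) (rule F)
    also have "\<dots> = ?r"
      by (rule finsum_cong') (auto simp: D F_def finsum_rdistr)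
    finally show ?thesis .
  qed
  then show ?thesis by (simp add: free_algebra_def)
qed

lemma monomial_mult:
  "monomial R u \<otimes>\<^bsub>free_algebra R X\<^esub> monomial R v = monomial R (u @ v)"
proof
  fix w
  have "(monomial R u \<otimes>\<^bsub>free_algebra R X\<^esub> monomial R v) w
      = (\<Oplus>i\<in>{..length w}. monomial R u (take i w) \<otimes> monomial R v (drop i w))"
    by (simp add: free_algebra_def)
  also have "\<dots> = (\<Oplus>i\<in>{..length w}. if i = length u then monomial R (u @ v) w else \<zero>)"
  proof (rule finsum_cong')
    fix i assume "i \<in> {..length w}"
    then have "take i w = u \<and> drop i w = v \<longleftrightarrow> i = length u \<and> w = u @ v"
      by (metis append_eq_conv_conj append_take_drop_id atMost_iff length_take min.absorb2)
    then show "monomial R u (take i w) \<otimes> monomial R v (drop i w)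
        = (if i = length u then monomial R (u @ v) w else \<zero>)"
      by (cases "take i w = u"; cases "drop i w = v") (auto simp: monomial_def)
  qed (simp_all add: monomial_def)
  also have "\<dots> = monomial R (u @ v) w"
  proof (cases "length u \<le> length w")
    case True
    then show ?thesis
      by (intro finsum_delta) (auto simp: monomial_def)
  next
    \<comment> \<open>Now \<open>length u\<close> lies outside the range of summation, so the sum
      vanishes; the right side vanishes too, because w is too short to equal
      \<open>u @ v\<close>.\<close>
    case False
    then show ?thesis
      by (subst add.finprod_one_eqI) (auto simp: monomial_def)
  qed
  finally show "(monomial R u \<otimes>\<^bsub>free_algebra R X\<^esub> monomial R v) w = monomial R (u @ v) w" .
qed

lemma free_algebra_one: "\<one>\<^bsub>free_algebra R X\<^esub> = monomial R []"
  by (simp add: free_algebra_def monomial_def)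

text \<open>Only the empty prefix of w contributes. The case of the scalar 1 is the left unit law,
  and the general case makes ideals closed under scalars.\<close>

lemma free_algebra_scalar_mult:
  assumes a: "a \<in> carrier R" and f: "f \<in> carrier (free_algebra R X)"
  shows "(\<lambda>w. a \<otimes> monomial R [] w) \<otimes>\<^bsub>free_algebra R X\<^esub> f = (\<lambda>w. a \<otimes> f w)"
proof
  fix w
  note D = free_algebra_carrierD(1)[OF f]
  have "(\<Oplus>i\<in>{..length w}. a \<otimes> monomial R [] (take i w) \<otimes> f (drop i w))
      = (\<Oplus>i\<in>{..length w}. if i = 0 then a \<otimes> f w else \<zero>)"
  proof (rule finsum_cong')
    fix i assume "i \<in> {..length w}"
    then show "a \<otimes> monomial R [] (take i w) \<otimes> f (drop i w) = (if i = 0 then a \<otimes> f w else \<zero>)"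
      using a D by (cases "i = 0") (auto simp: monomial_def)
  qed (use a D in simp_all)
  also have "\<dots> = a \<otimes> f w"
    using a D by (intro finsum_delta) auto
  finally show "((\<lambda>w. a \<otimes> monomial R [] w) \<otimes>\<^bsub>free_algebra R X\<^esub> f) w = a \<otimes> f w"
    by (simp add: free_algebra_def)
qed

lemma free_algebra_r_one:
  assumes f: "f \<in> carrier (free_algebra R X)"
  shows "f \<otimes>\<^bsub>free_algebra R X\<^esub> \<one>\<^bsub>free_algebra R X\<^esub> = f"
proof
  fix w
  note D = free_algebra_carrierD(1)[OF f]
  have "(\<Oplus>i\<in>{..length w}. f (take i w) \<otimes> monomial R [] (drop i w))
      = (\<Oplus>i\<in>{..length w}. if i = length w then f w else \<zero>)"
  proof (rule finsum_cong')
    fix i assume "i \<in> {..length w}"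
    then show "f (take i w) \<otimes> monomial R [] (drop i w) = (if i = length w then f w else \<zero>)"
      using D by (cases "i = length w") (auto simp: monomial_def)
  qed (use D in simp_all)
  also have "\<dots> = f w"
    using D by (intro finsum_delta) auto
  finally show "(f \<otimes>\<^bsub>free_algebra R X\<^esub> \<one>\<^bsub>free_algebra R X\<^esub>) w = f w"
    by (simp add: free_algebra_def monomial_def)
qed

lemma free_algebra_ring: "ring (free_algebra R X)" (is "ring ?A")
proof (rule ringI)
  show "abelian_group ?A" by (rule free_algebra_abelian_group)
  show "Group.monoid ?A"
  proof (rule monoidI)
    show "\<one>\<^bsub>?A\<^esub> \<in> carrier ?A"
      by (simp add: free_algebra_one monomial_closed)
    fix f assume f: "f \<in> carrier ?A"
    show "f \<otimes>\<^bsub>?A\<^esub> \<one>\<^bsub>?A\<^esub> = f" by (rule free_algebra_r_one[OF f])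
    have 1: "(\<lambda>w. \<one> \<otimes> monomial R [] w) = monomial R ([] :: 'c list)" "(\<lambda>w. \<one> \<otimes> f w) = f"
      using free_algebra_carrierD(1)[OF f] by (auto simp: monomial_def)
    show "\<one>\<^bsub>?A\<^esub> \<otimes>\<^bsub>?A\<^esub> f = f"
      using free_algebra_scalar_mult[OF one_closed f] by (simp only: 1 free_algebra_one)
  qed (rule free_algebra_mult_closed free_algebra_mult_assoc; assumption)+
next
  fix f g h assume f: "f \<in> carrier ?A" and g: "g \<in> carrier ?A" and h: "h \<in> carrier ?A"
  note D = free_algebra_carrierD(1)[OF f] free_algebra_carrierD(1)[OF g] free_algebra_carrierD(1)[OF h]
  show "(f \<oplus>\<^bsub>?A\<^esub> g) \<otimes>\<^bsub>?A\<^esub> h = f \<otimes>\<^bsub>?A\<^esub> h \<oplus>\<^bsub>?A\<^esub> g \<otimes>\<^bsub>?A\<^esub> h"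
    by (simp add: free_algebra_def fun_eq_iff D l_distr finsum_addf)
  show "h \<otimes>\<^bsub>?A\<^esub> (f \<oplus>\<^bsub>?A\<^esub> g) = h \<otimes>\<^bsub>?A\<^esub> f \<oplus>\<^bsub>?A\<^esub> h \<otimes>\<^bsub>?A\<^esub> g"
    by (simp add: free_algebra_def fun_eq_iff D r_distr finsum_addf)
qed

end

lemma (in field) free_algebra_vectorspace: "vectorspace R (free_algebra R X)"
proof -
  have "module R (free_algebra R X)" (is "module R ?A")
  proof (rule moduleI)
    show "cring R" by (rule is_cring)
    show "abelian_group ?A" by (rule free_algebra_abelian_group)
    fix a f assume a: "a \<in> carrier R" and f: "f \<in> carrier ?A"
    note D = free_algebra_carrierD[OF f]
    show "a \<odot>\<^bsub>?A\<^esub> f \<in> carrier ?A"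
      using a D by (intro free_algebra_carrierI[of _ "{w. f w \<noteq> \<zero>}"]) (auto simp: free_algebra_def)
  qed (simp_all add: free_algebra_def fun_eq_iff l_distr r_distr m_assoc)
  then show ?thesis
    by (simp add: vectorspace_def field_axioms)
qed


section \<open>Quotients by subspaces and ideals\<close>

text \<open>Closure under negation comes from scaling by -1.\<close>

lemma subspace_abelian_subgroup:
  assumes "subspace K U M"
  shows "abelian_subgroup U M"
proof -
  interpret vectorspace K M using assms by (simp add: subspace_def)
  have sub: "submodule K U M" using assms by (simp add: subspace_def)
  have "additive_subgroup U M"
  proof (rule additive_subgroupI, rule group.subgroupI)
    show "group (add_monoid M)" by (rule M.a_group)
    show "inv\<^bsub>add_monoid M\<^esub> x \<in> U" if "x \<in> U" for x
    proof -
      have "x \<in> carrier M" using submodule.subset[OF sub] that by blast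
      then have "\<ominus>\<^bsub>M\<^esub> x = (\<ominus>\<^bsub>K\<^esub> \<one>\<^bsub>K\<^esub>) \<odot>\<^bsub>M\<^esub> x"
        by (simp add: smult_minus_1)
      then show ?thesis
        using submodule.smult_closed[OF sub _ that, of "\<ominus>\<^bsub>K\<^esub> \<one>\<^bsub>K\<^esub>"] by (simp add: a_inv_def)
    qed
  qed (use submodule.subset[OF sub] submodule.m_closed[OF sub] submodule.zero_closed[OF sub] in auto)
  then show ?thesis by (rule abelian_subgroupI3) (rule M.abelian_group_axioms)
qed

lemma (in abelian_subgroup) a_rcos_eq_iff:
  assumes "x \<in> carrier G" "y \<in> carrier G"
  shows "H +> x = H +> y \<longleftrightarrow> x \<ominus> y \<in> H"
  using a_rcos_module[OF assms(2,1)] a_rcos_self[OF assms(1)]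
    a_repr_independence[OF _ assms(2) a_subgroup, of x]
  by (auto simp: minus_eq)

text \<open>\<open>coset_smult\<close> unites the cosets coming from all representatives. They
  coincide: two representatives differ by an element of U, and its multiple by a stays in U.\<close>

lemma coset_smult_rcos:
  assumes U: "subspace K U M" and a: "a \<in> carrier K" and x: "x \<in> carrier M"
  shows "coset_smult M U a (U +>\<^bsub>M\<^esub> x) = U +>\<^bsub>M\<^esub> (a \<odot>\<^bsub>M\<^esub> x)"
proof -
  interpret vectorspace K M using U by (simp add: subspace_def)
  interpret U: submodule K U M using U by (simp add: subspace_def)
  interpret G: abelian_subgroup U M by (rule subspace_abelian_subgroup) fact
  have "U +>\<^bsub>M\<^esub> (a \<odot>\<^bsub>M\<^esub> y) = U +>\<^bsub>M\<^esub> (a \<odot>\<^bsub>M\<^esub> x)" if y: "y \<in> U +>\<^bsub>M\<^esub> x" for y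
  proof -
    obtain u where u: "u \<in> U" "y = u \<oplus>\<^bsub>M\<^esub> x"
      using y by (auto simp: a_r_coset_def')
    have uc: "u \<in> carrier M" using u U.subset by blast
    have "a \<odot>\<^bsub>M\<^esub> y \<ominus>\<^bsub>M\<^esub> a \<odot>\<^bsub>M\<^esub> x = a \<odot>\<^bsub>M\<^esub> u"
      using a x u uc by (simp add: smult_r_distr M.minus_eq M.a_assoc M.r_neg)
    then show ?thesis
      using a x u uc by (subst G.a_rcos_eq_iff) auto
  qed
  moreover have "x \<in> U +>\<^bsub>M\<^esub> x" by (rule G.a_rcos_self[OF x])
  ultimately show ?thesis unfolding coset_smult_def by blast
qed

text \<open>Fixing only four fields of N lets the lemma serve both the quotient algebra and the
  quotient spaces of representations, whose multiplications differ.\<close>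

lemma quotient_map_hom:
  fixes N :: "('k, 'a set, 'n) module_scheme" and M :: "('k, 'a, 'm) module_scheme"
  assumes U: "subspace K U M"
    and N: "carrier N = a_rcosets\<^bsub>M\<^esub> U" "zero N = U" "add N = set_add M" "smult N = coset_smult M U"
  shows "(\<lambda>x. U +>\<^bsub>M\<^esub> x) \<in> module_hom K M N"
    and "(\<lambda>x. U +>\<^bsub>M\<^esub> x) ` carrier M = carrier N"
    and "U +>\<^bsub>M\<^esub> \<zero>\<^bsub>M\<^esub> = \<zero>\<^bsub>N\<^esub>"
proof -
  interpret vectorspace K M using U by (simp add: subspace_def)
  interpret U: submodule K U M using U by (simp add: subspace_def)
  interpret G: abelian_subgroup U M by (rule subspace_abelian_subgroup) fact
  show im: "(\<lambda>x. U +>\<^bsub>M\<^esub> x) ` carrier M = carrier N"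
    by (auto simp: N A_RCOSETS_def')
  show "U +>\<^bsub>M\<^esub> \<zero>\<^bsub>M\<^esub> = \<zero>\<^bsub>N\<^esub>"
    by (simp add: N U.subset)
  show "(\<lambda>x. U +>\<^bsub>M\<^esub> x) \<in> module_hom K M N"
    unfolding module_hom_def using im
    by (auto simp: N(3,4) coset_smult_rcos[OF U] G.a_rcos_sum)
qed

lemma quotient_algebra_simps:
  "carrier (quotient_algebra A I) = a_rcosets\<^bsub>A\<^esub> I" "zero (quotient_algebra A I) = I"
  "add (quotient_algebra A I) = set_add A" "smult (quotient_algebra A I) = coset_smult A I"
  by (simp_all add: quotient_algebra_def ring.extend_def module.fields_def FactRing_def)

section \<open>Finite dimensional quotients of the free algebra\<close>

lemma (in field) free_algebra_ideal_subspace: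
  assumes I: "ideal I (free_algebra R X)"
  shows "subspace R I (free_algebra R X)" (is "subspace R I ?A")
proof -
  interpret I: ideal I ?A by fact
  have vs: "vectorspace R ?A" by (rule free_algebra_vectorspace)
  interpret vectorspace R ?A by (rule vs)
  have one: "\<one>\<^bsub>?A\<^esub> \<in> carrier ?A" by simp
  have "a \<odot>\<^bsub>?A\<^esub> f \<in> I" if a: "a \<in> carrier R" and f: "f \<in> I" for a f
  proof -
    have fc: "f \<in> carrier ?A" using f I.a_subset by blast
    have "a \<odot>\<^bsub>?A\<^esub> f = (a \<odot>\<^bsub>?A\<^esub> \<one>\<^bsub>?A\<^esub>) \<otimes>\<^bsub>?A\<^esub> f"
      using free_algebra_scalar_mult[OF a fc] by (simp add: free_algebra_def monomial_def)
    then show ?thesis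
      using I.I_l_closed[OF f smult_closed[OF a one]] by simp
  qed
  then have "submodule R I ?A"
    using I.a_subset by (intro submodule.intro) (auto intro: module_axioms)
  then show ?thesis using vs by (simp add: subspace_def)
qed

lemma (in field) free_algebra_quotient_fin_dim:
  assumes I: "ideal I (free_algebra R X)"
    and fin: "finite ((\<lambda>w. I +>\<^bsub>free_algebra R X\<^esub> monomial R w) ` lists X)"
  shows "fin_dim_space R (quotient_algebra (free_algebra R X) I)"
proof -
  let ?A = "free_algebra R X"
  let ?N = "quotient_algebra ?A I"
  define p where "p f = I +>\<^bsub>?A\<^esub> f" for f
  let ?S = "(\<lambda>w. p (monomial R w)) ` lists X"
  have sub: "subspace R I ?A" by (rule free_algebra_ideal_subspace[OF I])
  note hom = quotient_map_hom[OF sub quotient_algebra_simps, folded p_def]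
  have vs: "vectorspace R ?N"
  proof (rule vectorspace_linear_image)
    show "vectorspace R ?A" by (rule free_algebra_vectorspace)
    show "p \<in> module_hom R ?A ?N" by (rule hom)
    show "p ` carrier ?A = carrier ?N" by (rule hom)
    show "p \<zero>\<^bsub>?A\<^esub> = \<zero>\<^bsub>?N\<^esub>" by (rule hom)
  qed
  interpret A: vectorspace R ?A by (rule free_algebra_vectorspace)
  interpret N: vectorspace R ?N by (rule vs)
  have pc: "p f \<in> carrier ?N" if "f \<in> carrier ?A" for f
    using that hom(2) by blast
  have S: "?S \<subseteq> carrier ?N"
    using pc[OF monomial_closed] by blast
  have span: "submodule R (N.span ?S) ?N" by (rule N.span_is_submodule[OF S])
  \<comment> \<open>The induction runs over any finite set containing the support. Thus it also
    proceeds when the coefficient at the removed word w happens to be zero; otherwise the term at w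
    is split off and \<open>f(w := \<zero>)\<close> is supported in the smaller set.\<close>
  have "p f \<in> N.span ?S" if "finite T" "f \<in> carrier ?A" "{w. f w \<noteq> \<zero>} \<subseteq> T" for T f
    using that
  proof (induction T arbitrary: f rule: finite_induct)
    case empty
    then have "f = \<zero>\<^bsub>?A\<^esub>" by (auto simp: free_algebra_def)
    then show ?case
      using hom(3) submodule.zero_closed[OF span] by simp
  next
    case (insert w T)
    note D = free_algebra_carrierD[OF insert.prems(1)]
    show ?case
    proof (cases "f w = \<zero>")
      case True
      then show ?thesis
        by (intro insert.IH[OF insert.prems(1)]) (use insert.prems(2) in auto)
    next
      case False
      then have w: "w \<in> lists X" using D(3) by blast
      let ?g = "f(w := \<zero>)"
      have g: "?g \<in> carrier ?A"
        using D by (intro free_algebra_carrierI[of _ "{w. f w \<noteq> \<zero>}"]) auto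
      have m: "monomial R w \<in> carrier ?A" by (rule monomial_closed[OF w])
      have "f = f w \<odot>\<^bsub>?A\<^esub> monomial R w \<oplus>\<^bsub>?A\<^esub> ?g"
        using D(1) by (simp add: free_algebra_def monomial_def fun_eq_iff)
      then have "p f = p (f w \<odot>\<^bsub>?A\<^esub> monomial R w \<oplus>\<^bsub>?A\<^esub> ?g)"
        by (rule arg_cong)
      also have "\<dots> = p (f w \<odot>\<^bsub>?A\<^esub> monomial R w) \<oplus>\<^bsub>?N\<^esub> p ?g"
        by (rule module_hom_add[OF hom(1) A.module.smult_closed[OF D(1) m] g])
      also have "p (f w \<odot>\<^bsub>?A\<^esub> monomial R w) = f w \<odot>\<^bsub>?N\<^esub> p (monomial R w)"
        by (rule module_hom_smult[OF hom(1) D(1) m])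
      finally have "p f = f w \<odot>\<^bsub>?N\<^esub> p (monomial R w) \<oplus>\<^bsub>?N\<^esub> p ?g" .
      moreover have "p ?g \<in> N.span ?S"
        by (rule insert.IH[OF g]) (use insert.prems(2) in auto)
      moreover have "p (monomial R w) \<in> N.span ?S"
        using N.in_own_span[OF S] imageI[OF w] by (rule subsetD)
      ultimately show ?thesis
        using submodule.m_closed[OF span submodule.smult_closed[OF span D(1)]] by simp
    qed
  qed
  then have "p f \<in> N.span ?S" if "f \<in> carrier ?A" for f
    using free_algebra_carrierD(2)[OF that] that by blast
  then have "carrier ?N \<subseteq> N.span ?S"
    unfolding hom(2)[symmetric] by (rule image_subsetI)
  then have "N.gen_set ?S"
    using N.span_is_subset2[OF S] by (rule equalityI[rotated])
  then have "N.fin_dim"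
    unfolding N.fin_dim_def using S fin by (auto simp: p_def)
  then show ?thesis using vs by (simp add: fin_dim_space_def)
qed

section \<open>The algebra B_Q\<close>

lemma free_gen_monomial: "free_gen K t = monomial K [t]"
  by (simp add: free_gen_def monomial_def)

lemma B_algebra_fin_dim:
  fixes K :: "('k, 'r) ring_scheme" and Q :: "('v, 'e) pre_digraph"
  assumes "field K" and "fin_digraph Q" and "\<nexists>p. pre_digraph.cycle Q p"
  shows "fin_dim_space K (B_algebra K Q)"
proof -
  interpret K: field K by fact
  interpret Q: fin_digraph Q by fact
  let ?X = "verts Q"
  let ?A = "free_algebra K ?X"
  interpret A: ring ?A by (rule K.free_algebra_ring)
  let ?m = "monomial K"
  let ?R = "{l \<ominus>\<^bsub>?A\<^esub> r | l r. (l, r) \<in> B_relations K Q}"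
  define I where "I = genideal ?A ?R"
  note mc = K.monomial_closed and mm = K.monomial_mult
  \<comment> \<open>With generators written as one-letter monomials, every relation equates two
    monomials, so modulo I it simply identifies two words.\<close>
  have rels: "B_relations K Q =
        {(?m [s, s], ?m [s]) | s. s \<in> ?X}
      \<union> {(?m [s, t, s], ?m [t, s, t]) | s t. s \<in> ?X \<and> t \<in> ?X}
      \<union> {(?m [t, s, t], ?m [s, t]) | s t. s \<in> ?X \<and> t \<in> ?X \<and> \<not> t \<rightarrow>\<^bsub>Q\<^esub> s}"
    by (simp add: B_relations_def Let_def free_gen_monomial mm)
  have "l \<in> carrier ?A \<and> r \<in> carrier ?A" if "(l, r) \<in> B_relations K Q" for l r
    using that by (auto simp: rels intro!: mc)
  then have R: "?R \<subseteq> carrier ?A" by auto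
  have I: "ideal I ?A" unfolding I_def by (rule A.genideal_ideal[OF R])
  interpret I: ideal I ?A by (rule I)
  define p where "p w = I +>\<^bsub>?A\<^esub> ?m w" for w
  have rel: "p u = p v" if "(?m u, ?m v) \<in> B_relations K Q" "u \<in> lists ?X" "v \<in> lists ?X" for u v
  proof -
    have "?m u \<ominus>\<^bsub>?A\<^esub> ?m v \<in> I"
      unfolding I_def using A.genideal_self[OF R] that(1) by blast
    then show ?thesis
      unfolding p_def
      using abelian_subgroup.a_rcos_eq_iff[OF abelian_subgroupI3[OF I.is_additive_subgroup A.is_abelian_group]
          mc[OF that(2)] mc[OF that(3)]] by blast
  qed
  have "finite (p ` lists ?X)"
  proof (rule finite_image_lists_absorb[where g = "rcoset_mult ?A I" and R = "\<lambda>t s. t \<rightarrow>\<^bsub>Q\<^esub> s"])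
    show "p (u @ v) = rcoset_mult ?A I (p u) (p v)" if "u \<in> lists ?X" "v \<in> lists ?X" for u v
      unfolding p_def using that by (subst I.rcoset_mult_add) (auto simp: mm intro!: mc)
    show "p [s, s] = p [s]" if "s \<in> ?X" for s
      by (rule rel) (use that in \<open>auto simp: rels\<close>)
    show "p [s, t, s] = p [s, t]" if "s \<in> ?X" "t \<in> ?X" "\<not> t \<rightarrow>\<^bsub>Q\<^esub> s" for s t
    proof -
      have "p [s, t, s] = p [t, s, t]"
        by (rule rel) (use that in \<open>auto simp: rels\<close>)
      also have "\<dots> = p [s, t]"
        by (rule rel) (use that in \<open>auto simp: rels\<close>)
      finally show ?thesis .
    qed
    show "\<exists>m\<in>Y. \<forall>t\<in>Y. \<not> t \<rightarrow>\<^bsub>Q\<^esub> m" if "Y \<subseteq> ?X" "Y \<noteq> {}" for Y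
      by (rule Q.source_exists) (use that assms(3) in auto)
  qed simp
  then have "fin_dim_space K (quotient_algebra ?A I)"
    unfolding p_def by (rule K.free_algebra_quotient_fin_dim[OF I])
  then show ?thesis
    by (simp add: B_algebra_def presented_algebra_def Let_def I_def)
qed


section \<open>Coordinates and linear maps\<close>

lemma module_homI:
  assumes "\<And>x. x \<in> carrier M \<Longrightarrow> f x \<in> carrier N"
    and "\<And>x y. x \<in> carrier M \<Longrightarrow> y \<in> carrier M \<Longrightarrow> f (x \<oplus>\<^bsub>M\<^esub> y) = f x \<oplus>\<^bsub>N\<^esub> f y"
    and "\<And>a x. a \<in> carrier K \<Longrightarrow> x \<in> carrier M \<Longrightarrow> f (a \<odot>\<^bsub>M\<^esub> x) = a \<odot>\<^bsub>N\<^esub> f x"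
  shows "f \<in> module_hom K M N"
  using assms by (simp add: module_hom_def)

lemma module_hom_in_carrier: "f \<in> module_hom K M N \<Longrightarrow> x \<in> carrier M \<Longrightarrow> f x \<in> carrier N"
  by (auto simp: module_hom_def)

lemma module_hom_zero:
  assumes "module K M" "module K N" "f \<in> module_hom K M N"
  shows "f \<zero>\<^bsub>M\<^esub> = \<zero>\<^bsub>N\<^esub>"
proof -
  interpret mod_hom K M N f
    using assms by (simp add: mod_hom_def mod_hom_axioms_def)
  show ?thesis by (rule f0_is_0)
qed

lemma module_hom_minus:
  assumes "module K M" "module K N" "f \<in> module_hom K M N" "x \<in> carrier M" "y \<in> carrier M"
  shows "f (x \<ominus>\<^bsub>M\<^esub> y) = f x \<ominus>\<^bsub>N\<^esub> f y"
proof -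
  interpret mod_hom K M N f
    using assms by (simp add: mod_hom_def mod_hom_axioms_def)
  show ?thesis by (rule f_minus) fact+
qed

lemma module_hom_comp:
  assumes "f \<in> module_hom K L M" "g \<in> module_hom K M N"
  shows "(\<lambda>x. g (f x)) \<in> module_hom K L N"
  using assms by (auto simp: module_hom_def Pi_iff)

lemma module_hom_cong:
  assumes "f \<in> module_hom K M N" "module K M" "\<And>x. x \<in> carrier M \<Longrightarrow> f x = g x"
  shows "g \<in> module_hom K M N"
proof -
  interpret module K M by fact
  show ?thesis
    using assms(1) by (auto simp: module_hom_def Pi_iff simp flip: assms(3))
qed

text \<open>Every element and every operation of N lifts along p, so linearity of g can be read off
  from h. This yields the inverse coordinate map, the arrow maps of a quotient, and all morphisms
  induced on quotients.\<close>

lemma module_hom_factor: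
  assumes M: "module K M" and p: "p \<in> module_hom K M N" "p ` carrier M = carrier N"
    and h: "h \<in> module_hom K M N'" and g: "\<And>x. x \<in> carrier M \<Longrightarrow> g (p x) = h x"
  shows "g \<in> module_hom K N N'"
proof -
  interpret module K M by fact
  have ex: "\<exists>x\<in>carrier M. y = p x" if "y \<in> carrier N" for y
    using that p(2) by blast
  show ?thesis
  proof (rule module_homI)
    show "g y \<in> carrier N'" if "y \<in> carrier N" for y
      using ex[OF that] g module_hom_in_carrier[OF h] by auto
    show "g (y \<oplus>\<^bsub>N\<^esub> z) = g y \<oplus>\<^bsub>N'\<^esub> g z" if "y \<in> carrier N" "z \<in> carrier N" for y z
      using ex[OF that(1)] ex[OF that(2)] g module_hom_add[OF h] module_hom_add[OF p(1), symmetric] by auto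
    show "g (a \<odot>\<^bsub>N\<^esub> y) = a \<odot>\<^bsub>N'\<^esub> g y" if "a \<in> carrier K" "y \<in> carrier N" for a y
      using ex[OF that(2)] that(1) g module_hom_smult[OF h] module_hom_smult[OF p(1), symmetric] by auto
  qed
qed

text \<open>A set independent in U is independent in M, hence has at most dim M elements. The empty
  set is independent, so a maximal independent set exists; it is a finite basis of U.\<close>

lemma fin_dim_space_subspace:
  assumes M: "fin_dim_space K M" and U: "subspace K U M"
  shows "fin_dim_space K (M\<lparr>carrier := U\<rparr>)"
proof -
  interpret V: vectorspace K M using M by (simp add: fin_dim_space_def)
  have sub: "submodule K U M" using U by (simp add: subspace_def)
  have vs: "vectorspace K (M\<lparr>carrier := U\<rparr>)" by (rule V.subspace_is_vs[OF U])
  interpret U: vectorspace K "M\<lparr>carrier := U\<rparr>" by (rule vs)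
  have fd: "V.fin_dim" using M by (simp add: fin_dim_space_def)
  have li: "finite S \<and> card S \<le> V.dim" if "S \<subseteq> carrier (M\<lparr>carrier := U\<rparr>) \<and> U.lin_indpt S" for S
  proof -
    have S: "S \<subseteq> U" using that by simp
    then have "V.lin_indpt S" "S \<subseteq> carrier M"
      using V.span_li_not_depend(2)[OF S sub] that submodule.subset[OF sub] by auto
    then show ?thesis using V.li_le_dim[OF fd] by blast
  qed
  have "{} \<subseteq> carrier (M\<lparr>carrier := U\<rparr>) \<and> U.lin_indpt {}"
    by (auto simp: U.lin_dep_def)
  then obtain S where S: "finite S" "maximal S (\<lambda>S. S \<subseteq> carrier (M\<lparr>carrier := U\<rparr>) \<and> U.lin_indpt S)"
    using maximal_exists[of "\<lambda>S. S \<subseteq> carrier (M\<lparr>carrier := U\<rparr>) \<and> U.lin_indpt S", OF li] by blast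
  then have "U.basis S" by (intro U.max_li_is_basis)
  then have "U.fin_dim"
    using S(1) by (auto simp: U.fin_dim_def U.basis_def)
  then show ?thesis using vs by (simp add: fin_dim_space_def)
qed

text \<open>L is the ground field as a space over itself; prescribing its fields rather than its
  record allows it to be \<open>space (simple_rep K t) t\<close>. The isomorphism takes coordinates
  in a finite basis and then numbers the basis vectors.\<close>

lemma fin_dim_space_iso_power:
  fixes K :: "('k, 'r) ring_scheme" and M :: "('k, 'a, 'm) module_scheme" and L :: "('k, 'k) module"
  assumes M: "fin_dim_space K M"
    and L: "carrier L = carrier K" "zero L = zero K" "add L = add K" "smult L = mult K"
  shows "\<exists>n f. f \<in> module_hom K M (space_power n L) \<and> bij_betw f (carrier M) (carrier (space_power n L))"
proof -
  interpret V: vectorspace K M using M by (simp add: fin_dim_space_def)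
  obtain B where B: "finite B" "V.basis B"
    using V.finite_basis_exists M by (auto simp: fin_dim_space_def)
  then have BM: "B \<subseteq> carrier M" by (simp add: V.basis_def)
  let ?F = "V.func_space B"
  let ?T = "\<lambda>a. V.lincomb a B"
  interpret T: mod_hom K ?F M ?T by (rule V.lincomb_is_mod_hom[OF B(1) BM])
  have cF: "carrier ?F = (B \<rightarrow>\<^sub>E carrier K)" by (simp add: V.func_space_def)
  have ex1: "\<exists>!a. a \<in> carrier ?F \<and> ?T a = v" if "v \<in> carrier M" for v
    using V.basis_criterion[OF B(1) BM] B(2) that by (simp add: cF)
  have bij: "bij_betw ?T (carrier ?F) (carrier M)"
    unfolding bij_betw_def
  proof
    show "inj_on ?T (carrier ?F)"
      using ex1 by (intro inj_onI) (metis T.f_im)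
    show "?T ` carrier ?F = carrier M"
      using ex1 T.f_im by (fastforce simp: image_iff)
  qed
  \<comment> \<open>The coordinate map is the inverse of forming linear combinations; it is linear
    because its composite with that map is the identity.\<close>
  define c where "c = inv_into (carrier ?F) ?T"
  have c: "c \<in> module_hom K M ?F"
  proof (rule module_hom_factor[where p = ?T and M = ?F and h = "\<lambda>a. a"])
    show "c (?T a) = a" if "a \<in> carrier ?F" for a
      unfolding c_def by (rule bij_betw_inv_into_left[OF bij that])
  qed (use T.f_hom bij in \<open>auto simp: bij_betw_def module_hom_def T.M.module_axioms\<close>)
  obtain h where h: "bij_betw h {..<card B} B"
    using B(1) ex_bij_betw_nat_finite[of B] by (auto simp: atLeast0LessThan)
  let ?P = "space_power (card B) L"
  let ?r = "\<lambda>a. \<lambda>i\<in>{..<card B}. a (h i)"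
  have hB: "h i \<in> B" if "i < card B" for i
    using h that by (auto simp: bij_betw_def)
  have r: "?r \<in> module_hom K ?F ?P"
    by (rule module_homI)
      (auto simp: V.func_space_def space_power_def L hB fun_eq_iff)
  have "bij_betw ?r (carrier ?F) (carrier ?P)"
  proof (rule bij_betw_byWitness[where f' = "\<lambda>a. \<lambda>b\<in>B. a (inv_into {..<card B} h b)"])
    have "inv_into {..<card B} h b < card B" "h (inv_into {..<card B} h b) = b" if "b \<in> B" for b
      using h that inv_into_into[of b h "{..<card B}"] by (auto simp: bij_betw_def f_inv_into_f)
    note inv = this
    have inv': "inv_into {..<card B} h (h i) = i" if "i < card B" for i
      using h that by (simp add: bij_betw_inv_into_left)
    show "\<forall>a\<in>carrier ?F. (\<lambda>b\<in>B. ?r a (inv_into {..<card B} h b)) = a"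
      by (auto simp: cF inv fun_eq_iff PiE_def extensional_def)
    show "\<forall>a\<in>carrier ?P. ?r (\<lambda>b\<in>B. a (inv_into {..<card B} h b)) = a"
      by (auto simp: space_power_def hB inv' fun_eq_iff PiE_def extensional_def)
    show "?r ` carrier ?F \<subseteq> carrier ?P"
      using module_hom_in_carrier[OF r] by blast
    show "(\<lambda>a. \<lambda>b\<in>B. a (inv_into {..<card B} h b)) ` carrier ?P \<subseteq> carrier ?F"
      using inv(1) by (auto simp: cF space_power_def L PiE_def Pi_iff)
  qed
  then have "bij_betw (\<lambda>x. ?r (c x)) (carrier M) (carrier ?P)"
    using bij_betw_trans[OF bij_betw_inv_into[OF bij], of ?r "carrier ?P"] by (simp add: c_def comp_def)
  moreover have "(\<lambda>x. ?r (c x)) \<in> module_hom K M ?P"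
    by (rule module_hom_comp[OF c r])
  ultimately show ?thesis by blast
qed


section \<open>Torsion subrepresentations\<close>

lemma transport_space_hom:
  assumes inj: "inj_on h (carrier M)" and M: "module K M"
  shows "h \<in> module_hom K M (transport_space h M)"
    and "h ` carrier M = carrier (transport_space h M)"
    and "h \<zero>\<^bsub>M\<^esub> = \<zero>\<^bsub>transport_space h M\<^esub>"
proof -
  interpret module K M by fact
  show "h \<in> module_hom K M (transport_space h M)"
    by (rule module_homI) (simp_all add: transport_space_def Let_def inv_into_f_f[OF inj])
qed (simp_all add: transport_space_def Let_def)

text \<open>The chosen element lies in its coset, and distinct cosets are disjoint.\<close>

lemma (in abelian_subgroup) pick_inj: "inj_on pick (a_rcosets H)"
proof (rule inj_onI)
  fix C D assume C: "C \<in> a_rcosets H" and D: "D \<in> a_rcosets H" and eq: "pick C = pick D"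
  have "pick E \<in> E" if E: "E \<in> a_rcosets H" for E
  proof -
    obtain x where "x \<in> carrier G" "E = H +> x"
      using E by (auto simp: A_RCOSETS_def')
    then have "x \<in> E" using a_rcos_self by simp
    then show ?thesis unfolding pick_def by (rule someI)
  qed
  then have "pick C \<in> C" "pick C \<in> D"
    using C D eq by metis+
  then show "C = D"
    using a_rcos_disjoint C D unfolding pairwise_def disjnt_def by blast
qed

text \<open>Induced maps on quotients are defined as unions over all representatives. Since f
  carries U into W, all cosets in the union agree. This evaluates both the arrow maps of a quotient
  and the action of the functor on morphisms.\<close>

lemma coset_map_rcos:
  assumes U: "subspace K U M" and W: "subspace K W N" and f: "f \<in> module_hom K M N"
    and fU: "f ` U \<subseteq> W" and x: "x \<in> carrier M"
  shows "(\<Union>y\<in>U +>\<^bsub>M\<^esub> x. W +>\<^bsub>N\<^esub> f y) = W +>\<^bsub>N\<^esub> f x"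
proof -
  interpret M: vectorspace K M using U by (simp add: subspace_def)
  interpret N: vectorspace K N using W by (simp add: subspace_def)
  interpret U: abelian_subgroup U M by (rule subspace_abelian_subgroup) fact
  interpret W: abelian_subgroup W N by (rule subspace_abelian_subgroup) fact
  have "W +>\<^bsub>N\<^esub> f y = W +>\<^bsub>N\<^esub> f x" if y: "y \<in> U +>\<^bsub>M\<^esub> x" for y
  proof -
    obtain u where u: "u \<in> U" "y = u \<oplus>\<^bsub>M\<^esub> x"
      using y by (auto simp: a_r_coset_def')
    have uc: "u \<in> carrier M" using u U.a_subset by blast
    then have yc: "y \<in> carrier M" using u x by simp
    have "y \<ominus>\<^bsub>M\<^esub> x = u"
      using x uc by (simp add: u M.M.minus_eq M.M.a_assoc M.M.r_neg)
    then have "f y \<ominus>\<^bsub>N\<^esub> f x = f u"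
      using module_hom_minus[OF M.module_axioms N.module_axioms f yc x] by simp
    then show ?thesis
      using fU u(1) module_hom_in_carrier[OF f] x yc by (subst W.a_rcos_eq_iff) auto
  qed
  moreover have "x \<in> U +>\<^bsub>M\<^esub> x" by (rule U.a_rcos_self[OF x])
  ultimately show ?thesis by blast
qed

text \<open>The kernel of the identity V -> V, from which all other kernels are built. The value off
  the vertices follows the convention in \<open>subrep\<close>.\<close>

definition zero_subrep :: "('v, 'e) pre_digraph \<Rightarrow> ('k, 'v, 'e, 'a) quiver_rep \<Rightarrow> 'v \<Rightarrow> 'a set" where
  "zero_subrep Q V = (\<lambda>s. if s \<in> verts Q then {\<zero>\<^bsub>space V s\<^esub>} else {})"

text \<open>If \<open>U\<close> is the kernel of a quotient map \<open>V \<rightarrow> V'\<close>, then \<open>extend_at Q V t U\<close> is the kernel of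
  \<open>V \<rightarrow> P\<^sub>t V'\<close>.\<close>

definition extend_at ::
    "('v, 'e) pre_digraph \<Rightarrow> ('k, 'v, 'e, 'a) quiver_rep \<Rightarrow> 'v \<Rightarrow> ('v \<Rightarrow> 'a set) \<Rightarrow> 'v \<Rightarrow> 'a set" where
  "extend_at Q V t U = U(t := {x \<in> carrier (space V t).
     \<forall>e\<in>arcs Q. tail Q e = t \<longrightarrow> arrow_map V e x \<in> U (head Q e)})"

lemma subrep_arrow:
  "subrep K Q V U \<Longrightarrow> e \<in> arcs Q \<Longrightarrow> x \<in> U (tail Q e) \<Longrightarrow> arrow_map V e x \<in> U (head Q e)"
  unfolding subrep_def by blast

section \<open>Torsion of representations of a loop-free quiver\<close>

locale quiver_over_field = K: field K + loopfree_digraph Q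
  for K :: "('k, 'r) ring_scheme" and Q :: "('v, 'e) pre_digraph"
begin

lemma
  fixes V :: "('k, 'v, 'e, 'a) quiver_rep"
  assumes "fin_dim_rep K Q V"
  shows rep_fin_dim_space: "s \<in> verts Q \<Longrightarrow> fin_dim_space K (space V s)"
    and rep_vectorspace: "s \<in> verts Q \<Longrightarrow> vectorspace K (space V s)"
    and rep_module: "s \<in> verts Q \<Longrightarrow> module K (space V s)"
    and rep_arrow_hom: "e \<in> arcs Q \<Longrightarrow> arrow_map V e \<in> module_hom K (space V (tail Q e)) (space V (head Q e))"
  using assms by (auto simp: fin_dim_rep_def fin_dim_space_def vectorspace_def)

lemma rep_arrow_zero:
  assumes V: "fin_dim_rep K Q V" and e: "e \<in> arcs Q"
  shows "arrow_map V e \<zero>\<^bsub>space V (tail Q e)\<^esub> = \<zero>\<^bsub>space V (head Q e)\<^esub>"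
  using e by (intro module_hom_zero[OF _ _ rep_arrow_hom[OF V e]] rep_module[OF V]) simp_all

lemma subrep_zero:
  assumes V: "fin_dim_rep K Q V"
  shows "subrep K Q V (zero_subrep Q V)"
proof -
  have "subspace K {\<zero>\<^bsub>space V s\<^esub>} (space V s)" if s: "s \<in> verts Q" for s
  proof -
    interpret vectorspace K "space V s" by (rule rep_vectorspace[OF V s])
    show ?thesis
      by (auto simp: subspace_def vectorspace_axioms intro!: submodule.intro module_axioms)
  qed
  then show ?thesis
    using rep_arrow_zero[OF V] by (auto simp: subrep_def zero_subrep_def)
qed

text \<open>Since U is closed under arrows, the operator can only enlarge U at t. Every arrow
  therefore sends the new family into the old U, and so into the new family.\<close>

lemma subrep_extend_at:
  assumes V: "fin_dim_rep K Q V" and t: "t \<in> verts Q" and U: "subrep K Q V U"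
  shows "subrep K Q V (extend_at Q V t U)"
proof -
  have sub: "submodule K (U s) (space V s)" if "s \<in> verts Q" for s
    using U that by (auto simp: subrep_def subspace_def)
  have arr: "arrow_map V e x \<in> U (head Q e)" if "e \<in> arcs Q" "x \<in> U (tail Q e)" for e x
    using subrep_arrow[OF U] that by blast
  interpret vectorspace K "space V t" by (rule rep_vectorspace[OF V t])
  have "submodule K (extend_at Q V t U t) (space V t)"
  proof (rule submodule.intro)
    show "module K (space V t)" by (rule module_axioms)
  qed (auto simp: extend_at_def rep_arrow_zero[OF V] submodule.zero_closed[OF sub]
      module_hom_add[OF rep_arrow_hom[OF V]] module_hom_smult[OF rep_arrow_hom[OF V]]
      submodule.m_closed[OF sub] submodule.smult_closed[OF sub])
  moreover have "U t \<subseteq> extend_at Q V t U t"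
    using submodule.subset[OF sub[OF t]] arr by (auto simp: extend_at_def)
  ultimately have t': "subspace K (extend_at Q V t U t) (space V t)" "U t \<subseteq> extend_at Q V t U t"
    by (simp_all add: subspace_def vectorspace_axioms)
  have ne: "extend_at Q V t U s = U s" if "s \<noteq> t" for s
    using that by (simp add: extend_at_def)
  show ?thesis
    unfolding subrep_def
  proof (intro conjI ballI allI impI)
    show "subspace K (extend_at Q V t U s) (space V s)" if "s \<in> verts Q" for s
      using that U t'(1) ne[of s] by (cases "s = t") (auto simp: subrep_def)
    show "extend_at Q V t U s = {}" if "s \<notin> verts Q" for s
      using that U t ne[of s] by (cases "s = t") (auto simp: subrep_def)
    fix e assume e: "e \<in> arcs Q"
    show "arrow_map V e ` extend_at Q V t U (tail Q e) \<subseteq> extend_at Q V t U (head Q e)"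
    proof (rule image_subsetI)
      fix x assume x: "x \<in> extend_at Q V t U (tail Q e)"
      have "arrow_map V e x \<in> U (head Q e)"
      proof (cases "tail Q e = t")
        case True
        then show ?thesis using x e by (auto simp: extend_at_def)
      next
        case False
        then show ?thesis using x e arr ne by auto
      qed
      then show "arrow_map V e x \<in> extend_at Q V t U (head Q e)"
        using t'(2) ne by (cases "head Q e = t") auto
    qed
  qed
qed

text \<open>This family is zero away from t, and all arrows act on it by zero, so a choice of
  coordinates on its space at t is already an isomorphism of representations.\<close>

lemma torsion_iso_power:
  fixes V :: "('k, 'v, 'e, 'a) quiver_rep"
  assumes V: "fin_dim_rep K Q V" and t: "t \<in> verts Q"
  shows "\<exists>n. rep_isomorphic K Q (restrict_rep V (extend_at Q V t (zero_subrep Q V)))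
    (rep_power n (simple_rep K t))"
proof -
  define T where "T = extend_at Q V t (zero_subrep Q V)"
  have T: "subrep K Q V T"
    unfolding T_def by (intro subrep_extend_at subrep_zero V t)
  have Ts: "T s = {\<zero>\<^bsub>space V s\<^esub>}" if "s \<in> verts Q" "s \<noteq> t" for s
    using that by (simp add: T_def extend_at_def zero_subrep_def)
  have TV: "T s \<subseteq> carrier (space V s)" if "s \<in> verts Q" for s
    using T that by (auto simp: subrep_def subspace_def dest: submodule.subset)
  have T0: "\<zero>\<^bsub>space V s\<^esub> \<in> T s" if "s \<in> verts Q" for s
    using T that by (auto simp: subrep_def subspace_def dest: submodule.zero_closed)
  let ?M = "(space V t)\<lparr>carrier := T t\<rparr>"
  let ?S = "simple_rep K t :: ('k, 'v, 'e, 'k) quiver_rep"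
  have fd: "fin_dim_space K ?M"
    using T t rep_fin_dim_space[OF V t] by (intro fin_dim_space_subspace) (auto simp: subrep_def)
  obtain n g where g: "g \<in> module_hom K ?M (space_power n (space ?S t))"
    and bij: "bij_betw g (T t) (carrier (space_power n (space ?S t)))"
    using fin_dim_space_iso_power[OF fd, of "space ?S t"] by (auto simp: simple_rep_def)
  let ?z = "\<lambda>i\<in>{..<n}. \<zero>\<^bsub>K\<^esub>"
  \<comment> \<open>Writing 0 as the multiple of 0 by the scalar 0 gives the value of g there
    without first making \<open>space_power\<close> a vector space.\<close>
  have g0: "g \<zero>\<^bsub>space V t\<^esub> = ?z"
  proof -
    interpret vectorspace K "space V t" by (rule rep_vectorspace[OF V t])
    have "g \<zero>\<^bsub>space V t\<^esub> = g (\<zero>\<^bsub>K\<^esub> \<odot>\<^bsub>?M\<^esub> \<zero>\<^bsub>space V t\<^esub>)"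
      by simp
    also have "\<dots> = \<zero>\<^bsub>K\<^esub> \<odot>\<^bsub>space_power n (space ?S t)\<^esub> g \<zero>\<^bsub>space V t\<^esub>"
      by (rule module_hom_smult[OF g]) (use T0 t in simp_all)
    also have "\<dots> = ?z"
      using module_hom_in_carrier[OF g, of "\<zero>\<^bsub>space V t\<^esub>"] T0[OF t]
      by (auto simp: space_power_def simple_rep_def fun_eq_iff PiE_def Pi_iff)
    finally show ?thesis .
  qed
  define f where "f = (\<lambda>s\<in>verts Q. \<lambda>x\<in>T s. if s = t then g x else ?z)"
  have sp: "space (restrict_rep V T) s = (space V s)\<lparr>carrier := T s\<rparr>" for s
    by (simp add: restrict_rep_def)
  have fz: "f s \<zero>\<^bsub>space V s\<^esub> = ?z" if "s \<in> verts Q" for s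
    using that T0 g0 by (auto simp: f_def)
  have "f \<in> rep_hom K Q (restrict_rep V T) (rep_power n ?S)"
    unfolding rep_hom_def
  proof (intro CollectI conjI ballI)
    show "f \<in> extensional (verts Q)" by (simp add: f_def)
    fix s assume s: "s \<in> verts Q"
    show "f s \<in> extensional (carrier (space (restrict_rep V T) s))"
      using s by (simp add: f_def sp)
    interpret vectorspace K "space V s" by (rule rep_vectorspace[OF V s])
    show "f s \<in> module_hom K (space (restrict_rep V T) s) (space (rep_power n ?S) s)"
    proof (cases "s = t")
      case True
      have "module K ?M" using fd by (simp add: fin_dim_space_def vectorspace_def)
      then show ?thesis
        using g s True by (auto simp: sp rep_power_def f_def intro: module_hom_cong)
    next
      case False
      then show ?thesis
        using s fz[OF s]
        by (intro module_homI) (auto simp: sp Ts rep_power_def space_power_def simple_rep_def fun_eq_iff)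
    qed
  next
    fix e x assume e: "e \<in> arcs Q" and x: "x \<in> carrier (space (restrict_rep V T) (tail Q e))"
    have x: "x \<in> T (tail Q e)" using x by (simp add: sp)
    have "arrow_map V e x = \<zero>\<^bsub>space V (head Q e)\<^esub>"
    proof (cases "tail Q e = t")
      case True
      then show ?thesis using x e
        by (auto simp: T_def extend_at_def zero_subrep_def)
    next
      case False
      then show ?thesis using x e rep_arrow_zero[OF V e] by (simp add: Ts)
    qed
    then show "f (head Q e) (arrow_map (restrict_rep V T) e x)
        = arrow_map (rep_power n ?S) e (f (tail Q e) x)"
      using e fz[of "head Q e"] by (simp add: restrict_rep_def rep_power_def simple_rep_def)
  qed
  moreover have "bij_betw (f s) (carrier (space (restrict_rep V T) s)) (carrier (space (rep_power n ?S) s))"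
    if s: "s \<in> verts Q" for s
  proof (cases "s = t")
    case True
    have "bij_betw (f t) (T t) (carrier (space_power n (space ?S t)))"
      using bij by (rule bij_betw_cong[THEN iffD1, rotated]) (use t in \<open>auto simp: f_def\<close>)
    then show ?thesis by (simp add: True sp rep_power_def)
  next
    case False
    \<comment> \<open>The power of a zero space has one element, so away from t the map is a
      bijection between one-element sets.\<close>
    have "{..<n} \<rightarrow>\<^sub>E {\<zero>\<^bsub>K\<^esub>} = {?z}"
      by (auto simp: PiE_def extensional_def fun_eq_iff)
    then show ?thesis
      using False s fz[OF s] by (simp add: sp Ts rep_power_def space_power_def simple_rep_def bij_betw_def)
  qed
  ultimately show ?thesis
    unfolding rep_isomorphic_def T_def by blast
qed

text \<open>Away from t the power of S_t has one-element spaces, and U s, being in bijection with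
  one of them, is zero. An arrow out of t is not a loop, so it ends at such a vertex and kills U
  t.\<close>

lemma torsion_greatest:
  fixes V :: "('k, 'v, 'e, 'a) quiver_rep"
  assumes V: "fin_dim_rep K Q V" and t: "t \<in> verts Q" and U: "subrep K Q V U"
    and iso: "rep_isomorphic K Q (restrict_rep V U) (rep_power n (simple_rep K t))"
  shows "U \<le> extend_at Q V t (zero_subrep Q V)"
proof (rule le_funI)
  let ?S = "simple_rep K t :: ('k, 'v, 'e, 'k) quiver_rep"
  obtain f where "\<forall>s\<in>verts Q. bij_betw (f s) (U s) (carrier (space_power n (space ?S s)))"
    using iso by (auto simp: rep_isomorphic_def restrict_rep_def rep_power_def)
  then have f: "bij_betw (f s) (U s) (carrier (space_power n (space ?S s)))" if "s \<in> verts Q" for s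
    using that by blast
  have U0: "U s \<subseteq> {\<zero>\<^bsub>space V s\<^esub>}" if s: "s \<in> verts Q" "s \<noteq> t" for s
  proof
    fix x assume x: "x \<in> U s"
    have z: "\<zero>\<^bsub>space V s\<^esub> \<in> U s"
      using U s by (auto simp: subrep_def subspace_def dest: submodule.zero_closed)
    have "f s ` U s = ({..<n} \<rightarrow>\<^sub>E {\<zero>\<^bsub>K\<^esub>})"
      using f[OF s(1)] s(2) by (simp add: bij_betw_def space_power_def simple_rep_def)
    then have "f s x \<in> {..<n} \<rightarrow>\<^sub>E {\<zero>\<^bsub>K\<^esub>}" "f s \<zero>\<^bsub>space V s\<^esub> \<in> {..<n} \<rightarrow>\<^sub>E {\<zero>\<^bsub>K\<^esub>}"
      using x z by blast+
    then have "f s x = f s \<zero>\<^bsub>space V s\<^esub>"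
      by (intro PiE_ext) auto
    then have "x = \<zero>\<^bsub>space V s\<^esub>"
      using f[OF s(1)] x z by (auto simp: bij_betw_def dest: inj_onD)
    then show "x \<in> {\<zero>\<^bsub>space V s\<^esub>}" by simp
  qed
  fix s
  show "U s \<le> extend_at Q V t (zero_subrep Q V) s"
  proof (cases "s = t")
    case True
    have "x \<in> carrier (space V t)" if "x \<in> U t" for x
      using U that t by (auto simp: subrep_def subspace_def dest: submodule.subset)
    moreover have "arrow_map V e x = \<zero>\<^bsub>space V (head Q e)\<^esub>"
      if "x \<in> U t" "e \<in> arcs Q" "tail Q e = t" for x e
    proof -
      have "arrow_map V e x \<in> U (head Q e)"
        using subrep_arrow[OF U that(2)] that(1,3) by simp
      then show ?thesis
        using U0[of "head Q e"] that no_loops[OF that(2)] by auto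
    qed
    ultimately show ?thesis
      by (auto simp: True extend_at_def zero_subrep_def)
  next
    case False
    then show ?thesis
      using U U0[of s] by (cases "s \<in> verts Q") (auto simp: extend_at_def zero_subrep_def subrep_def)
  qed
qed

text \<open>Replaces the abstract greatest element by the S_t-part of the socle: vectors at t
  annihilated by every outgoing arrow. All later kernel computations use this form.\<close>

lemma torsion_eq:
  assumes "fin_dim_rep K Q V" "t \<in> verts Q"
  shows "torsion K Q t V = extend_at Q V t (zero_subrep Q V)"
  unfolding torsion_def
  using assms by (intro Greatest_equality)
    (auto intro: subrep_extend_at subrep_zero torsion_iso_power torsion_greatest)

lemma subrep_torsion:
  assumes "fin_dim_rep K Q V" "t \<in> verts Q"
  shows "subrep K Q V (torsion K Q t V)"
  using assms by (simp add: torsion_eq subrep_extend_at subrep_zero)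

end


section \<open>Quotient functors\<close>

text \<open>Everything about P_t at a single vertex. The last clause undoes \<open>pick\<close>:
  arrow maps and morphisms on the copied quotient are defined by first recovering the coset.\<close>

lemma projected_space:
  fixes M :: "('k, 'a) module"
  assumes M: "fin_dim_space K M" and U: "subspace K U M"
  defines "N \<equiv> transport_space pick (quotient_space M U)"
    and "q \<equiv> \<lambda>x. pick (U +>\<^bsub>M\<^esub> x)"
  shows "fin_dim_space K N" and "q \<in> module_hom K M N" and "q ` carrier M = carrier N"
    and "\<And>x. x \<in> carrier M \<Longrightarrow> q x = \<zero>\<^bsub>N\<^esub> \<longleftrightarrow> x \<in> U"
    and "\<And>x. x \<in> carrier M \<Longrightarrow> inv_into (carrier (quotient_space M U)) pick (q x) = U +>\<^bsub>M\<^esub> x"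
proof -
  interpret vectorspace K M using U by (simp add: subspace_def)
  interpret U: abelian_subgroup U M by (rule subspace_abelian_subgroup) fact
  let ?C = "quotient_space M U"
  have C: "carrier ?C = a_rcosets\<^bsub>M\<^esub> U" "zero ?C = U" "add ?C = set_add M" "smult ?C = coset_smult M U"
    by (simp_all add: quotient_space_def)
  note c = quotient_map_hom[OF U C]
  have "vectorspace K ?C"
    by (rule vectorspace_linear_image[OF _ c]) (rule vectorspace_axioms)
  then have mC: "module K ?C" by (simp add: vectorspace_def)
  have inj: "inj_on pick (carrier ?C)"
    unfolding C by (rule U.pick_inj)
  note h = transport_space_hom[OF inj mC, folded N_def]
  show q: "q \<in> module_hom K M N"
    unfolding q_def by (rule module_hom_comp[OF c(1) h(1)])
  show surj: "q ` carrier M = carrier N"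
    unfolding q_def h(2)[symmetric] c(2)[symmetric] by (simp add: image_image)
  have q0: "q \<zero>\<^bsub>M\<^esub> = \<zero>\<^bsub>N\<^esub>"
    unfolding q_def c(3) by (rule h(3))
  show "fin_dim_space K N"
    by (rule fin_dim_space_linear_image[OF M q surj q0])
  have coset: "U +>\<^bsub>M\<^esub> x \<in> carrier ?C" if "x \<in> carrier M" for x
    using c(2) that by blast
  show "q x = \<zero>\<^bsub>N\<^esub> \<longleftrightarrow> x \<in> U" if x: "x \<in> carrier M" for x
  proof -
    have "q x = \<zero>\<^bsub>N\<^esub> \<longleftrightarrow> U +>\<^bsub>M\<^esub> x = U +>\<^bsub>M\<^esub> \<zero>\<^bsub>M\<^esub>"
      unfolding q0[symmetric] q_def using inj_on_eq_iff[OF inj coset[OF x] coset] by simp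
    also have "\<dots> \<longleftrightarrow> x \<in> U"
      using U.a_rcos_eq_iff[OF x M.zero_closed] x M.minus_equality[of "\<zero>\<^bsub>M\<^esub>" "\<zero>\<^bsub>M\<^esub>"]
      by (simp add: M.minus_eq)
    finally show ?thesis .
  qed
  show "inv_into (carrier ?C) pick (q x) = U +>\<^bsub>M\<^esub> x" if "x \<in> carrier M" for x
    unfolding q_def by (rule inv_into_f_f[OF inj coset[OF that]])
qed

lemma rep_homI:
  assumes "f \<in> extensional (verts Q)"
    and "\<And>s. s \<in> verts Q \<Longrightarrow> f s \<in> extensional (carrier (space V s))"
    and "\<And>s. s \<in> verts Q \<Longrightarrow> f s \<in> module_hom K (space V s) (space W s)"
    and "\<And>e x. e \<in> arcs Q \<Longrightarrow> x \<in> carrier (space V (tail Q e)) \<Longrightarrow>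
      f (head Q e) (arrow_map V e x) = arrow_map W e (f (tail Q e) x)"
  shows "f \<in> rep_hom K Q V W"
  using assms by (simp add: rep_hom_def)

lemma rep_homD:
  assumes "f \<in> rep_hom K Q V W"
  shows "f \<in> extensional (verts Q)"
    and "s \<in> verts Q \<Longrightarrow> f s \<in> extensional (carrier (space V s))"
    and "s \<in> verts Q \<Longrightarrow> f s \<in> module_hom K (space V s) (space W s)"
    and "e \<in> arcs Q \<Longrightarrow> x \<in> carrier (space V (tail Q e)) \<Longrightarrow>
      f (head Q e) (arrow_map V e x) = arrow_map W e (f (tail Q e) x)"
  using assms by (simp_all add: rep_hom_def)

lemma rep_hom_carrier:
  "f \<in> rep_hom K Q V W \<Longrightarrow> s \<in> verts Q \<Longrightarrow> x \<in> carrier (space V s) \<Longrightarrow> f s x \<in> carrier (space W s)"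
  by (rule module_hom_in_carrier[OF rep_homD(3)])

context quiver_over_field
begin

text \<open>A family h that completes the triangle over the surjection p inherits linearity and
  compatibility with arrows from r. It provides both the values of functors on morphisms and the
  comparison maps between functors.\<close>

lemma rep_hom_factor:
  assumes V: "fin_dim_rep K Q V"
    and p: "\<And>s. s \<in> verts Q \<Longrightarrow> p s \<in> module_hom K (space V s) (space V' s)"
      "\<And>s. s \<in> verts Q \<Longrightarrow> p s ` carrier (space V s) = carrier (space V' s)"
      "\<And>e x. e \<in> arcs Q \<Longrightarrow> x \<in> carrier (space V (tail Q e)) \<Longrightarrow>
        arrow_map V' e (p (tail Q e) x) = p (head Q e) (arrow_map V e x)"
    and r: "\<And>s. s \<in> verts Q \<Longrightarrow> r s \<in> module_hom K (space V s) (space W s)"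
      "\<And>e x. e \<in> arcs Q \<Longrightarrow> x \<in> carrier (space V (tail Q e)) \<Longrightarrow>
        arrow_map W e (r (tail Q e) x) = r (head Q e) (arrow_map V e x)"
    and h: "h \<in> extensional (verts Q)" "\<And>s. s \<in> verts Q \<Longrightarrow> h s \<in> extensional (carrier (space V' s))"
      "\<And>s x. s \<in> verts Q \<Longrightarrow> x \<in> carrier (space V s) \<Longrightarrow> h s (p s x) = r s x"
  shows "h \<in> rep_hom K Q V' W"
proof (rule rep_homI)
  show "h s \<in> module_hom K (space V' s) (space W s)" if s: "s \<in> verts Q" for s
    by (rule module_hom_factor[OF rep_module[OF V s] p(1,2)[OF s] r(1)[OF s] h(3)[OF s]])
  fix e y assume e: "e \<in> arcs Q" and y: "y \<in> carrier (space V' (tail Q e))"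
  have st: "tail Q e \<in> verts Q" "head Q e \<in> verts Q" using e by simp_all
  obtain x where x: "x \<in> carrier (space V (tail Q e))" "y = p (tail Q e) x"
    using y p(2)[OF st(1)] by blast
  have "arrow_map V e x \<in> carrier (space V (head Q e))"
    using rep_arrow_hom[OF V e] x(1) by (rule module_hom_in_carrier)
  then show "h (head Q e) (arrow_map V' e y) = arrow_map W e (h (tail Q e) y)"
    using e x st p(3) r(2) h(3) by simp
qed (use h in auto)

end

text \<open>A functor \<open>F\<close> with a natural surjection \<open>p V : V \<rightarrow> F V\<close> of kernel \<open>N V\<close>.\<close>

locale quotient_functor = quiver_over_field K Q
  for K :: "('k, 'r) ring_scheme" and Q :: "('v, 'e) pre_digraph" +
  fixes F :: "(('k, 'v, 'e, 'a) quiver_rep, 'v \<Rightarrow> 'a \<Rightarrow> 'a) endofunctor"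
    and p :: "('k, 'v, 'e, 'a) quiver_rep \<Rightarrow> 'v \<Rightarrow> 'a \<Rightarrow> 'a"
    and N :: "('k, 'v, 'e, 'a) quiver_rep \<Rightarrow> 'v \<Rightarrow> 'a set"
  assumes obj_closed: "fin_dim_rep K Q V \<Longrightarrow> fin_dim_rep K Q (obj_map F V)"
    and proj_hom: "fin_dim_rep K Q V \<Longrightarrow> s \<in> verts Q \<Longrightarrow>
      p V s \<in> module_hom K (space V s) (space (obj_map F V) s)"
    and proj_surj: "fin_dim_rep K Q V \<Longrightarrow> s \<in> verts Q \<Longrightarrow>
      p V s ` carrier (space V s) = carrier (space (obj_map F V) s)"
    and proj_kernel: "fin_dim_rep K Q V \<Longrightarrow> s \<in> verts Q \<Longrightarrow> x \<in> carrier (space V s) \<Longrightarrow>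
      p V s x = \<zero>\<^bsub>space (obj_map F V) s\<^esub> \<longleftrightarrow> x \<in> N V s"
    and proj_arrow: "fin_dim_rep K Q V \<Longrightarrow> e \<in> arcs Q \<Longrightarrow> x \<in> carrier (space V (tail Q e)) \<Longrightarrow>
      arrow_map (obj_map F V) e (p V (tail Q e) x) = p V (head Q e) (arrow_map V e x)"
    and mor_closed: "fin_dim_rep K Q V \<Longrightarrow> fin_dim_rep K Q W \<Longrightarrow> f \<in> rep_hom K Q V W \<Longrightarrow>
      mor_map F V W f \<in> rep_hom K Q (obj_map F V) (obj_map F W)"
    and mor_proj: "fin_dim_rep K Q V \<Longrightarrow> fin_dim_rep K Q W \<Longrightarrow> f \<in> rep_hom K Q V W \<Longrightarrow>
      s \<in> verts Q \<Longrightarrow> x \<in> carrier (space V s) \<Longrightarrow> mor_map F V W f s (p V s x) = p W s (f s x)"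

context quiver_over_field
begin

lemma rep_hom_zero:
  assumes "fin_dim_rep K Q V" "fin_dim_rep K Q W" "f \<in> rep_hom K Q V W" "s \<in> verts Q"
  shows "f s \<zero>\<^bsub>space V s\<^esub> = \<zero>\<^bsub>space W s\<^esub>"
  by (rule module_hom_zero[OF rep_module[OF assms(1,4)] rep_module[OF assms(2,4)] rep_homD(3)[OF assms(3,4)]])

text \<open>A morphism commutes with arrows and preserves zero, so it maps annihilated vectors to
  annihilated vectors. This is what lets it descend to the quotients.\<close>

lemma rep_hom_torsion:
  assumes V: "fin_dim_rep K Q V" and W: "fin_dim_rep K Q W" and f: "f \<in> rep_hom K Q V W"
    and t: "t \<in> verts Q" and s: "s \<in> verts Q"
  shows "f s ` torsion K Q t V s \<subseteq> torsion K Q t W s"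
proof (cases "s = t")
  case True
  have "arrow_map W e (f t x) = \<zero>\<^bsub>space W (head Q e)\<^esub>"
    if "x \<in> carrier (space V t)" "e \<in> arcs Q" "tail Q e = t"
      "arrow_map V e x = \<zero>\<^bsub>space V (head Q e)\<^esub>" for x e
    using rep_homD(4)[OF f that(2), of x] that rep_hom_zero[OF V W f, of "head Q e"] by simp
  then show ?thesis
    using True t rep_hom_carrier[OF f t]
    by (auto simp: torsion_eq V W extend_at_def zero_subrep_def)
next
  case False
  then show ?thesis
    using s t rep_hom_zero[OF V W f s]
    by (auto simp: torsion_eq V W extend_at_def zero_subrep_def)
qed

lemma quotient_functor_projection:
  assumes t: "t \<in> verts Q"
  shows "quotient_functor K Q (projection_functor K Q t)
    (\<lambda>V s x. pick (torsion K Q t V s +>\<^bsub>space V s\<^esub> x)) (\<lambda>V. torsion K Q t V)"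
proof -
  let ?F = "projection_functor K Q t"
  define T where "T = (\<lambda>V :: ('k, 'v, 'e, 'a) quiver_rep. torsion K Q t V)"
  define q where "q = (\<lambda>(V :: ('k, 'v, 'e, 'a) quiver_rep) s x. pick (T V s +>\<^bsub>space V s\<^esub> x))"
  have obj: "obj_map ?F V = transport_rep pick Q (quotient_rep Q V (T V))"
    for V :: "('k, 'v, 'e, 'a) quiver_rep"
    by (simp add: projection_functor_def T_def)
  have sp: "space (obj_map ?F V) s = transport_space pick (quotient_space (space V s) (T V s))"
    for V :: "('k, 'v, 'e, 'a) quiver_rep" and s
    by (simp add: obj transport_rep_def quotient_rep_def)
  have sub: "subspace K (T V s) (space V s)" if "fin_dim_rep K Q V" "s \<in> verts Q"
    for V :: "('k, 'v, 'e, 'a) quiver_rep" and s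
    using subrep_torsion[OF that(1) t] that(2) by (simp add: subrep_def T_def)
  have ps: "fin_dim_space K (space (obj_map ?F V) s)"
    "q V s \<in> module_hom K (space V s) (space (obj_map ?F V) s)"
    "q V s ` carrier (space V s) = carrier (space (obj_map ?F V) s)"
    "\<And>x. x \<in> carrier (space V s) \<Longrightarrow> q V s x = \<zero>\<^bsub>space (obj_map ?F V) s\<^esub> \<longleftrightarrow> x \<in> T V s"
    "\<And>x. x \<in> carrier (space V s) \<Longrightarrow>
      inv_into (carrier (quotient_space (space V s) (T V s))) pick (q V s x) = T V s +>\<^bsub>space V s\<^esub> x"
    if "fin_dim_rep K Q V" "s \<in> verts Q" for V :: "('k, 'v, 'e, 'a) quiver_rep" and s
    using projected_space[OF rep_fin_dim_space[OF that] sub[OF that]] by (simp_all add: sp q_def)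
  have arrow: "arrow_map (obj_map ?F V) e (q V (tail Q e) x) = q V (head Q e) (arrow_map V e x)"
    if V: "fin_dim_rep K Q V" and e: "e \<in> arcs Q" and x: "x \<in> carrier (space V (tail Q e))"
    for V :: "('k, 'v, 'e, 'a) quiver_rep" and e x
  proof -
    have st: "tail Q e \<in> verts Q" "head Q e \<in> verts Q" using e by simp_all
    have im: "arrow_map V e ` T V (tail Q e) \<subseteq> T V (head Q e)"
      using subrep_arrow[OF subrep_torsion[OF V t] e] by (auto simp: T_def)
    show ?thesis
      using ps(5)[OF V st(1) x]
        coset_map_rcos[OF sub[OF V st(1)] sub[OF V st(2)] rep_arrow_hom[OF V e] im x]
      by (simp add: obj transport_rep_def quotient_rep_def q_def)
  qed
  have mor: "mor_map ?F V W f s (q V s x) = q W s (f s x)"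
    if V: "fin_dim_rep K Q V" and W: "fin_dim_rep K Q W" and f: "f \<in> rep_hom K Q V W"
      and s: "s \<in> verts Q" and x: "x \<in> carrier (space V s)"
    for V W :: "('k, 'v, 'e, 'a) quiver_rep" and f s x
  proof -
    have im: "f s ` T V s \<subseteq> T W s"
      unfolding T_def by (rule rep_hom_torsion[OF V W f t s])
    \<comment> \<open>The functor's value on a morphism is restricted to chosen elements of cosets,
      so it can be evaluated at \<open>q V s x\<close> only once this element is known to be one of
      them.\<close>
    have "q V s x \<in> carrier (space (obj_map ?F V) s)"
      by (rule module_hom_in_carrier[OF ps(2)[OF V s] x])
    then have "q V s x \<in> pick ` carrier (quotient_space (space V s) (T V s))"
      by (simp add: sp transport_space_def Let_def)
    then show ?thesis
      using ps(5)[OF V s x] s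
        coset_map_rcos[OF sub[OF V s] sub[OF W s] rep_homD(3)[OF f s] im x]
      by (simp add: projection_functor_def quotient_rep_def q_def T_def)
  qed
  have "quotient_functor K Q ?F q T"
  proof
    fix V :: "('k, 'v, 'e, 'a) quiver_rep" assume V: "fin_dim_rep K Q V"
    show "fin_dim_rep K Q (obj_map ?F V)"
      unfolding fin_dim_rep_def
    proof (intro conjI ballI)
      show "fin_dim_space K (space (obj_map ?F V) s)" if "s \<in> verts Q" for s
        by (rule ps(1)[OF V that])
      fix e assume e: "e \<in> arcs Q"
      then have st: "tail Q e \<in> verts Q" "head Q e \<in> verts Q" by simp_all
      show "arrow_map (obj_map ?F V) e
          \<in> module_hom K (space (obj_map ?F V) (tail Q e)) (space (obj_map ?F V) (head Q e))"
        by (rule module_hom_factor[OF rep_module[OF V st(1)] ps(2,3)[OF V st(1)]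
              module_hom_comp[OF rep_arrow_hom[OF V e] ps(2)[OF V st(2)]] arrow[OF V e]])
    qed
    show "q V s \<in> module_hom K (space V s) (space (obj_map ?F V) s)"
      "q V s ` carrier (space V s) = carrier (space (obj_map ?F V) s)" if "s \<in> verts Q" for s
      using ps(2,3)[OF V that] .
    show "q V s x = \<zero>\<^bsub>space (obj_map ?F V) s\<^esub> \<longleftrightarrow> x \<in> T V s"
      if "s \<in> verts Q" "x \<in> carrier (space V s)" for s x
      using ps(4)[OF V that] .
    show "arrow_map (obj_map ?F V) e (q V (tail Q e) x) = q V (head Q e) (arrow_map V e x)"
      if "e \<in> arcs Q" "x \<in> carrier (space V (tail Q e))" for e x
      using arrow[OF V that] .
    fix W :: "('k, 'v, 'e, 'a) quiver_rep" and f
    assume W: "fin_dim_rep K Q W" and f: "f \<in> rep_hom K Q V W"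
    show "mor_map ?F V W f s (q V s x) = q W s (f s x)"
      if "s \<in> verts Q" "x \<in> carrier (space V s)" for s x
      using mor[OF V W f that] .
    show "mor_map ?F V W f \<in> rep_hom K Q (obj_map ?F V) (obj_map ?F W)"
    \<comment> \<open>The induced morphism is the factorization of f followed by \<open>q W\<close>
      through \<open>q V\<close>.\<close>
    proof (rule rep_hom_factor[OF V, where p = "q V" and r = "\<lambda>s x. q W s (f s x)"])
      fix s assume s: "s \<in> verts Q"
      show "q V s \<in> module_hom K (space V s) (space (obj_map ?F V) s)"
        "q V s ` carrier (space V s) = carrier (space (obj_map ?F V) s)"
        using ps(2,3)[OF V s] .
      show "(\<lambda>x. q W s (f s x)) \<in> module_hom K (space V s) (space (obj_map ?F W) s)"
        by (rule module_hom_comp[OF rep_homD(3)[OF f s] ps(2)[OF W s]])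
      show "mor_map ?F V W f s \<in> extensional (carrier (space (obj_map ?F V) s))"
        using s unfolding sp
        by (simp add: transport_space_def Let_def projection_functor_def quotient_rep_def T_def)
      show "mor_map ?F V W f s (q V s x) = q W s (f s x)" if "x \<in> carrier (space V s)" for x
        using mor[OF V W f s that] .
    next
      fix e x assume e: "e \<in> arcs Q" and x: "x \<in> carrier (space V (tail Q e))"
      show "arrow_map (obj_map ?F V) e (q V (tail Q e) x) = q V (head Q e) (arrow_map V e x)"
        using arrow[OF V e x] .
      have "f (tail Q e) x \<in> carrier (space W (tail Q e))"
        using e by (intro rep_hom_carrier[OF f _ x]) simp
      then show "arrow_map (obj_map ?F W) e (q W (tail Q e) (f (tail Q e) x))
          = q W (head Q e) (f (head Q e) (arrow_map V e x))"
        using arrow[OF W e] rep_homD(4)[OF f e x] by simp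
    qed (simp add: projection_functor_def)
  qed
  then show ?thesis by (simp add: q_def T_def)
qed

lemma quotient_functor_identity:
  "quotient_functor K Q identity_functor (\<lambda>V s x. x) (\<lambda>V. zero_subrep Q V)"
  by unfold_locales
    (auto simp: identity_functor_def zero_subrep_def module_hom_def)

text \<open>A vector p x at t is torsion in F V iff each arrow e out of t kills it. As p commutes
  with arrows, this says that e sends x into the kernel N V, which is the condition in
  \<open>extend_at\<close>. At other vertices the torsion is zero and the kernel stays the
  same.\<close>

lemma quotient_functor_comp_projection:
  fixes F :: "(('k, 'v, 'e, 'a) quiver_rep, 'v \<Rightarrow> 'a \<Rightarrow> 'a) endofunctor"
  assumes F: "quotient_functor K Q F p N" and t: "t \<in> verts Q"
  shows "quotient_functor K Q (projection_functor K Q t \<circ>\<^sub>F F)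
    (\<lambda>V s x. pick (torsion K Q t (obj_map F V) s +>\<^bsub>space (obj_map F V) s\<^esub> p V s x))
    (\<lambda>V. extend_at Q V t (N V))"
proof -
  interpret F: quotient_functor K Q F p N by (rule F)
  interpret P: quotient_functor K Q "projection_functor K Q t"
    "\<lambda>V s x. pick (torsion K Q t V s +>\<^bsub>space V s\<^esub> x)" "\<lambda>V. torsion K Q t V"
    by (rule quotient_functor_projection[OF t])
  have car: "p V s x \<in> carrier (space (obj_map F V) s)"
    if "fin_dim_rep K Q V" "s \<in> verts Q" "x \<in> carrier (space V s)" for V s x
    using module_hom_in_carrier[OF F.proj_hom] that by blast
  have ker: "p V s x \<in> torsion K Q t (obj_map F V) s \<longleftrightarrow> x \<in> extend_at Q V t (N V) s"
    if V: "fin_dim_rep K Q V" and s: "s \<in> verts Q" and x: "x \<in> carrier (space V s)" for V s x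
  proof (cases "s = t")
    case True
    have "arrow_map (obj_map F V) e (p V t x) = \<zero>\<^bsub>space (obj_map F V) (head Q e)\<^esub>
        \<longleftrightarrow> arrow_map V e x \<in> N V (head Q e)" if e: "e \<in> arcs Q" "tail Q e = t" for e
      using F.proj_arrow[OF V e(1), of x] e x True
        F.proj_kernel[OF V, of "head Q e" "arrow_map V e x"]
        module_hom_in_carrier[OF rep_arrow_hom[OF V e(1)], of x] by simp
    then show ?thesis
      using True x car[OF V s x] t
      by (auto simp: torsion_eq[OF F.obj_closed[OF V] t] extend_at_def zero_subrep_def)
  next
    case False
    then show ?thesis
      using s F.proj_kernel[OF V s x]
      by (simp add: torsion_eq[OF F.obj_closed[OF V] t] extend_at_def zero_subrep_def)
  qed
  have obj: "obj_map (projection_functor K Q t \<circ>\<^sub>F F) V = obj_map (projection_functor K Q t) (obj_map F V)" for V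
    by (simp add: functor_comp_def)
  have mor: "mor_map (projection_functor K Q t \<circ>\<^sub>F F) V W f
      = mor_map (projection_functor K Q t) (obj_map F V) (obj_map F W) (mor_map F V W f)" for V W f
    by (simp add: functor_comp_def)
  show ?thesis
  proof (unfold_locales, unfold obj mor)
    fix V :: "('k, 'v, 'e, 'a) quiver_rep" assume V: "fin_dim_rep K Q V"
    note FV = F.obj_closed[OF V]
    show "fin_dim_rep K Q (obj_map (projection_functor K Q t) (obj_map F V))"
      by (rule P.obj_closed[OF FV])
    fix s assume s: "s \<in> verts Q"
    show "(\<lambda>x. pick (torsion K Q t (obj_map F V) s +>\<^bsub>space (obj_map F V) s\<^esub> p V s x))
        \<in> module_hom K (space V s) (space (obj_map (projection_functor K Q t) (obj_map F V)) s)"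
      by (rule module_hom_comp[OF F.proj_hom[OF V s] P.proj_hom[OF FV s]])
    show "(\<lambda>x. pick (torsion K Q t (obj_map F V) s +>\<^bsub>space (obj_map F V) s\<^esub> p V s x)) ` carrier (space V s)
        = carrier (space (obj_map (projection_functor K Q t) (obj_map F V)) s)"
      unfolding P.proj_surj[OF FV s, symmetric] F.proj_surj[OF V s, symmetric] by (simp add: image_image)
    show "pick (torsion K Q t (obj_map F V) s +>\<^bsub>space (obj_map F V) s\<^esub> p V s x)
        = \<zero>\<^bsub>space (obj_map (projection_functor K Q t) (obj_map F V)) s\<^esub> \<longleftrightarrow> x \<in> extend_at Q V t (N V) s"
      if x: "x \<in> carrier (space V s)" for x
      using P.proj_kernel[OF FV s car[OF V s x]] ker[OF V s x] by simp
  next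
    fix V :: "('k, 'v, 'e, 'a) quiver_rep" and e x
    assume V: "fin_dim_rep K Q V" and e: "e \<in> arcs Q" and x: "x \<in> carrier (space V (tail Q e))"
    have "p V (tail Q e) x \<in> carrier (space (obj_map F V) (tail Q e))"
      using car[OF V _ x] e by simp
    then show "arrow_map (obj_map (projection_functor K Q t) (obj_map F V)) e
          (pick (torsion K Q t (obj_map F V) (tail Q e) +>\<^bsub>space (obj_map F V) (tail Q e)\<^esub> p V (tail Q e) x))
        = pick (torsion K Q t (obj_map F V) (head Q e) +>\<^bsub>space (obj_map F V) (head Q e)\<^esub> p V (head Q e) (arrow_map V e x))"
      using P.proj_arrow[OF F.obj_closed[OF V] e] F.proj_arrow[OF V e x] by simp
  next
    fix V W :: "('k, 'v, 'e, 'a) quiver_rep" and f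
    assume V: "fin_dim_rep K Q V" and W: "fin_dim_rep K Q W" and f: "f \<in> rep_hom K Q V W"
    note FV = F.obj_closed[OF V] and FW = F.obj_closed[OF W] and Ff = F.mor_closed[OF V W f]
    show "mor_map (projection_functor K Q t) (obj_map F V) (obj_map F W) (mor_map F V W f)
        \<in> rep_hom K Q (obj_map (projection_functor K Q t) (obj_map F V))
            (obj_map (projection_functor K Q t) (obj_map F W))"
      by (rule P.mor_closed[OF FV FW Ff])
    show "mor_map (projection_functor K Q t) (obj_map F V) (obj_map F W) (mor_map F V W f) s
          (pick (torsion K Q t (obj_map F V) s +>\<^bsub>space (obj_map F V) s\<^esub> p V s x))
        = pick (torsion K Q t (obj_map F W) s +>\<^bsub>space (obj_map F W) s\<^esub> p W s (f s x))"
      if "s \<in> verts Q" "x \<in> carrier (space V s)" for s x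
      using P.mor_proj[OF FV FW Ff that(1) car[OF V that]] F.mor_proj[OF V W f that] by simp
  qed
qed

end


section \<open>Natural isomorphisms\<close>

text \<open>Composites are extensional, so an equation between them is an equation on elements of
  the carriers; the categorical notions are unfolded into this form below.\<close>

lemma restrict_compose_eq_iff:
  "(\<lambda>s\<in>S. compose (A s) (g s) (f s)) = (\<lambda>s\<in>S. compose (A s) (g' s) (f' s)) \<longleftrightarrow>
    (\<forall>s\<in>S. \<forall>x\<in>A s. g s (f s x) = g' s (f' s x))"
  by (auto simp: fun_eq_iff compose_def)

lemma restrict_compose_eq_id_iff:
  "(\<lambda>s\<in>S. compose (A s) (g s) (f s)) = (\<lambda>s\<in>S. \<lambda>x\<in>A s. x) \<longleftrightarrow>
    (\<forall>s\<in>S. \<forall>x\<in>A s. g s (f s x) = x)"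
  by (auto simp: fun_eq_iff compose_def)

lemma iso_in_rep_category:
  "iso_in (rep_category K Q) V W f \<longleftrightarrow> f \<in> rep_hom K Q V W \<and> (\<exists>g\<in>rep_hom K Q W V.
    (\<forall>s\<in>verts Q. \<forall>x\<in>carrier (space V s). g s (f s x) = x) \<and>
    (\<forall>s\<in>verts Q. \<forall>y\<in>carrier (space W s). f s (g s y) = y))"
  by (simp add: iso_in_def rep_category_def restrict_compose_eq_id_iff)

lemma naturally_isomorphic_rep_category:
  "naturally_isomorphic (rep_category K Q) F G \<longleftrightarrow> (\<exists>\<eta>.
    (\<forall>V. fin_dim_rep K Q V \<longrightarrow> iso_in (rep_category K Q) (obj_map F V) (obj_map G V) (\<eta> V)) \<and>
    (\<forall>V W f. fin_dim_rep K Q V \<longrightarrow> fin_dim_rep K Q W \<longrightarrow> f \<in> rep_hom K Q V W \<longrightarrow>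
      (\<forall>s\<in>verts Q. \<forall>x\<in>carrier (space (obj_map F V) s).
        \<eta> W s (mor_map F V W f s x) = mor_map G V W f s (\<eta> V s x))))"
  by (simp add: naturally_isomorphic_def rep_category_def restrict_compose_eq_iff) blast

lemma finite_image_factor:
  assumes "finite (\<phi> ` A)" and "\<And>x y. x \<in> A \<Longrightarrow> y \<in> A \<Longrightarrow> \<phi> x = \<phi> y \<Longrightarrow> c x = c y"
  shows "finite (c ` A)"
proof -
  have "c x = c (inv_into A \<phi> (\<phi> x))" if "x \<in> A" for x
    using that by (intro assms(2)) (auto intro: inv_into_into simp: f_inv_into_f)
  then have "c ` A = (\<lambda>y. c (inv_into A \<phi> y)) ` \<phi> ` A"
    by (auto simp: image_iff)
  then show ?thesis using assms(1) by simp
qed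

context quiver_over_field
begin

lemma rep_hom_comp:
  assumes U: "fin_dim_rep K Q U" and f: "f \<in> rep_hom K Q U V" and g: "g \<in> rep_hom K Q V W"
  shows "(\<lambda>s\<in>verts Q. compose (carrier (space U s)) (g s) (f s)) \<in> rep_hom K Q U W"
proof (rule rep_homI)
  fix s assume s: "s \<in> verts Q"
  have "(\<lambda>x. g s (f s x)) \<in> module_hom K (space U s) (space W s)"
    by (rule module_hom_comp[OF rep_homD(3)[OF f s] rep_homD(3)[OF g s]])
  then show "(\<lambda>s\<in>verts Q. compose (carrier (space U s)) (g s) (f s)) s \<in> module_hom K (space U s) (space W s)"
    by (rule module_hom_cong[OF _ rep_module[OF U s]]) (use s in \<open>simp add: compose_def\<close>)
  show "(\<lambda>s\<in>verts Q. compose (carrier (space U s)) (g s) (f s)) s \<in> extensional (carrier (space U s))"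
    using s by (simp add: compose_def)
next
  fix e x assume e: "e \<in> arcs Q" and x: "x \<in> carrier (space U (tail Q e))"
  have st: "tail Q e \<in> verts Q" "head Q e \<in> verts Q" using e by simp_all
  have "arrow_map U e x \<in> carrier (space U (head Q e))"
    by (rule module_hom_in_carrier[OF rep_arrow_hom[OF U e] x])
  moreover have "g (head Q e) (f (head Q e) (arrow_map U e x)) = arrow_map W e (g (tail Q e) (f (tail Q e) x))"
    unfolding rep_homD(4)[OF f e x] by (rule rep_homD(4)[OF g e rep_hom_carrier[OF f st(1) x]])
  ultimately show "(\<lambda>s\<in>verts Q. compose (carrier (space U s)) (g s) (f s)) (head Q e) (arrow_map U e x)
      = arrow_map W e ((\<lambda>s\<in>verts Q. compose (carrier (space U s)) (g s) (f s)) (tail Q e) x)"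
    using st x by (simp add: compose_def)
qed simp

end

section \<open>Comparison of quotient functors with equal kernels\<close>

context quotient_functor
begin

lemma proj_in_carrier:
  "fin_dim_rep K Q V \<Longrightarrow> s \<in> verts Q \<Longrightarrow> x \<in> carrier (space V s) \<Longrightarrow>
    p V s x \<in> carrier (space (obj_map F V) s)"
  by (rule module_hom_in_carrier[OF proj_hom])

lemma proj_eq_iff:
  assumes V: "fin_dim_rep K Q V" and s: "s \<in> verts Q"
    and x: "x \<in> carrier (space V s)" and y: "y \<in> carrier (space V s)"
  shows "p V s x = p V s y \<longleftrightarrow> x \<ominus>\<^bsub>space V s\<^esub> y \<in> N V s"
proof -
  interpret V: vectorspace K "space V s" by (rule rep_vectorspace[OF V s])
  interpret F: vectorspace K "space (obj_map F V) s" by (rule rep_vectorspace[OF obj_closed[OF V] s])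
  have "p V s (x \<ominus>\<^bsub>space V s\<^esub> y) = p V s x \<ominus>\<^bsub>space (obj_map F V) s\<^esub> p V s y"
    by (rule module_hom_minus[OF V.module_axioms F.module_axioms proj_hom[OF V s] x y])
  then show ?thesis
    using proj_kernel[OF V s V.M.minus_closed[OF x y]]
      F.M.minus_other_side[OF proj_in_carrier[OF V s x] proj_in_carrier[OF V s y]] by simp
qed

text \<open>The candidate for an isomorphism F V -> G V: lift along p by an arbitrary preimage, then
  apply q. The choice of the lift does not matter once the kernels of p and q agree.\<close>

definition compare ::
    "(('k, 'v, 'e, 'a) quiver_rep \<Rightarrow> 'v \<Rightarrow> 'a \<Rightarrow> 'a) \<Rightarrow> ('k, 'v, 'e, 'a) quiver_rep \<Rightarrow> 'v \<Rightarrow> 'a \<Rightarrow> 'a" where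
  "compare q V = (\<lambda>s\<in>verts Q. \<lambda>y\<in>carrier (space (obj_map F V) s).
    q V s (inv_into (carrier (space V s)) (p V s) y))"

lemma compare_proj:
  assumes G: "quotient_functor K Q G q N'" and V: "fin_dim_rep K Q V"
    and N: "\<And>s. s \<in> verts Q \<Longrightarrow> N V s = N' V s"
    and s: "s \<in> verts Q" and x: "x \<in> carrier (space V s)"
  shows "compare q V s (p V s x) = q V s x"
proof -
  interpret G: quotient_functor K Q G q N' by (rule G)
  let ?x = "inv_into (carrier (space V s)) (p V s) (p V s x)"
  have im: "p V s x \<in> p V s ` carrier (space V s)" using x by blast
  have "p V s ?x = p V s x" "?x \<in> carrier (space V s)"
    using f_inv_into_f[OF im] inv_into_into[OF im] .
  then have "q V s ?x = q V s x"
    using proj_eq_iff[OF V s _ x] G.proj_eq_iff[OF V s _ x] N[OF s] by simp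
  then show ?thesis
    using s proj_in_carrier[OF V s x] by (simp add: compare_def)
qed

lemma compare_hom:
  assumes G: "quotient_functor K Q G q N'" and V: "fin_dim_rep K Q V"
    and N: "\<And>s. s \<in> verts Q \<Longrightarrow> N V s = N' V s"
  shows "compare q V \<in> rep_hom K Q (obj_map F V) (obj_map G V)"
proof -
  interpret G: quotient_functor K Q G q N' by (rule G)
  show ?thesis
  proof (rule rep_hom_factor[OF V proj_hom[OF V] proj_surj[OF V] proj_arrow[OF V]
        G.proj_hom[OF V] G.proj_arrow[OF V]])
    show "compare q V \<in> extensional (verts Q)"
      by (simp add: compare_def)
    show "compare q V s \<in> extensional (carrier (space (obj_map F V) s))" if "s \<in> verts Q" for s
      using that by (simp add: compare_def)
    show "compare q V s (p V s x) = q V s x" if "s \<in> verts Q" "x \<in> carrier (space V s)" for s x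
      using compare_proj[OF G V N that] .
  qed
qed

text \<open>The comparison maps in the two directions exchange p x and q x. Since p and q are
  surjective and natural, mutual inverseness and naturality need only be checked on such
  elements.\<close>

lemma naturally_isomorphic_if_same_kernel:
  assumes G: "quotient_functor K Q G q N'"
    and N: "\<And>V s. fin_dim_rep K Q V \<Longrightarrow> s \<in> verts Q \<Longrightarrow> N V s = N' V s"
  shows "naturally_isomorphic (rep_category K Q) F G"
proof -
  interpret G: quotient_functor K Q G q N' by (rule G)
  note FF = quotient_functor_axioms
  have c: "compare q V s (p V s x) = q V s x" and d: "G.compare p V s (q V s x) = p V s x"
    if V: "fin_dim_rep K Q V" and "s \<in> verts Q" "x \<in> carrier (space V s)" for V s x
    using compare_proj[OF G V N[OF V] that(2,3)] G.compare_proj[OF FF V N[OF V, symmetric] that(2,3)]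
    by simp_all
  have surj: "\<exists>x\<in>carrier (space V s). y = p V s x"
    if "fin_dim_rep K Q V" "s \<in> verts Q" "y \<in> carrier (space (obj_map F V) s)" for V s y
    using proj_surj[OF that(1,2)] that(3) by blast
  have G_surj: "\<exists>x\<in>carrier (space V s). y = q V s x"
    if "fin_dim_rep K Q V" "s \<in> verts Q" "y \<in> carrier (space (obj_map G V) s)" for V s y
    using G.proj_surj[OF that(1,2)] that(3) by blast
  have "iso_in (rep_category K Q) (obj_map F V) (obj_map G V) (compare q V)" if V: "fin_dim_rep K Q V" for V
    unfolding iso_in_rep_category
  proof (intro conjI bexI[where x = "G.compare p V"] ballI)
    show "compare q V \<in> rep_hom K Q (obj_map F V) (obj_map G V)"
      by (rule compare_hom[OF G V N[OF V]])
    show "G.compare p V \<in> rep_hom K Q (obj_map G V) (obj_map F V)"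
      by (rule G.compare_hom[OF FF V N[OF V, symmetric]])
    show "G.compare p V s (compare q V s y) = y" if s: "s \<in> verts Q" and y: "y \<in> carrier (space (obj_map F V) s)" for s y
      using surj[OF V s y] by (auto simp: c[OF V s] d[OF V s])
    show "compare q V s (G.compare p V s y) = y" if s: "s \<in> verts Q" and y: "y \<in> carrier (space (obj_map G V) s)" for s y
      using G_surj[OF V s y] by (auto simp: c[OF V s] d[OF V s])
  qed
  moreover have "compare q W s (mor_map F V W f s y) = mor_map G V W f s (compare q V s y)"
    if V: "fin_dim_rep K Q V" and W: "fin_dim_rep K Q W" and f: "f \<in> rep_hom K Q V W"
      and s: "s \<in> verts Q" and y: "y \<in> carrier (space (obj_map F V) s)" for V W f s y
  proof -
    obtain x where x: "x \<in> carrier (space V s)" "y = p V s x" using surj[OF V s y] by blast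
    then show ?thesis
      using mor_proj[OF V W f s x(1)] G.mor_proj[OF V W f s x(1)]
        c[OF V s x(1)] c[OF W s rep_hom_carrier[OF f s x(1)]] by simp
  qed
  ultimately show ?thesis
    unfolding naturally_isomorphic_rep_category by blast
qed

text \<open>The class of a composite contains every naturally isomorphic composite, whatever its
  kernel, so equality of classes calls for transitivity in addition to the comparison of
  kernels.\<close>

lemma naturally_isomorphic_trans:
  assumes FG: "naturally_isomorphic (rep_category K Q) F G"
    and GH: "naturally_isomorphic (rep_category K Q) G H"
    and G: "\<And>V. fin_dim_rep K Q V \<Longrightarrow> fin_dim_rep K Q (obj_map G V)"
    and H: "\<And>V. fin_dim_rep K Q V \<Longrightarrow> fin_dim_rep K Q (obj_map H V)"
  shows "naturally_isomorphic (rep_category K Q) F H"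
proof -
  obtain \<eta> where
    iso1: "\<And>V. fin_dim_rep K Q V \<Longrightarrow> iso_in (rep_category K Q) (obj_map F V) (obj_map G V) (\<eta> V)"
    and nat1: "\<And>V W f s x. fin_dim_rep K Q V \<Longrightarrow> fin_dim_rep K Q W \<Longrightarrow> f \<in> rep_hom K Q V W \<Longrightarrow>
      s \<in> verts Q \<Longrightarrow> x \<in> carrier (space (obj_map F V) s) \<Longrightarrow>
      \<eta> W s (mor_map F V W f s x) = mor_map G V W f s (\<eta> V s x)"
    using FG unfolding naturally_isomorphic_rep_category by blast
  obtain \<theta> where
    iso2: "\<And>V. fin_dim_rep K Q V \<Longrightarrow> iso_in (rep_category K Q) (obj_map G V) (obj_map H V) (\<theta> V)"
    and nat2: "\<And>V W f s x. fin_dim_rep K Q V \<Longrightarrow> fin_dim_rep K Q W \<Longrightarrow> f \<in> rep_hom K Q V W \<Longrightarrow>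
      s \<in> verts Q \<Longrightarrow> x \<in> carrier (space (obj_map G V) s) \<Longrightarrow>
      \<theta> W s (mor_map G V W f s x) = mor_map H V W f s (\<theta> V s x)"
    using GH unfolding naturally_isomorphic_rep_category by blast
  have hom1: "\<eta> V \<in> rep_hom K Q (obj_map F V) (obj_map G V)" if "fin_dim_rep K Q V" for V
    using iso1[OF that] by (simp add: iso_in_rep_category)
  have hom2: "\<theta> V \<in> rep_hom K Q (obj_map G V) (obj_map H V)" if "fin_dim_rep K Q V" for V
    using iso2[OF that] by (simp add: iso_in_rep_category)
  define \<kappa> where "\<kappa> V = (\<lambda>s\<in>verts Q. compose (carrier (space (obj_map F V) s)) (\<theta> V s) (\<eta> V s))" for V
  have \<kappa>: "\<kappa> V s x = \<theta> V s (\<eta> V s x)" if "s \<in> verts Q" "x \<in> carrier (space (obj_map F V) s)" for V s x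
    using that by (simp add: \<kappa>_def compose_def)
  have "iso_in (rep_category K Q) (obj_map F V) (obj_map H V) (\<kappa> V)" if V: "fin_dim_rep K Q V" for V
  proof -
    obtain g where g: "g \<in> rep_hom K Q (obj_map G V) (obj_map F V)"
      "\<And>s x. s \<in> verts Q \<Longrightarrow> x \<in> carrier (space (obj_map F V) s) \<Longrightarrow> g s (\<eta> V s x) = x"
      "\<And>s x. s \<in> verts Q \<Longrightarrow> x \<in> carrier (space (obj_map G V) s) \<Longrightarrow> \<eta> V s (g s x) = x"
      using iso1[OF V] unfolding iso_in_rep_category by blast
    obtain h where h: "h \<in> rep_hom K Q (obj_map H V) (obj_map G V)"
      "\<And>s x. s \<in> verts Q \<Longrightarrow> x \<in> carrier (space (obj_map G V) s) \<Longrightarrow> h s (\<theta> V s x) = x"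
      "\<And>s x. s \<in> verts Q \<Longrightarrow> x \<in> carrier (space (obj_map H V) s) \<Longrightarrow> \<theta> V s (h s x) = x"
      using iso2[OF V] unfolding iso_in_rep_category by blast
    let ?k = "\<lambda>s\<in>verts Q. compose (carrier (space (obj_map H V) s)) (g s) (h s)"
    note car = rep_hom_carrier[OF hom1[OF V]] rep_hom_carrier[OF hom2[OF V]]
      rep_hom_carrier[OF g(1)] rep_hom_carrier[OF h(1)]
    have "\<kappa> V \<in> rep_hom K Q (obj_map F V) (obj_map H V)"
      unfolding \<kappa>_def by (rule rep_hom_comp[OF obj_closed[OF V] hom1[OF V] hom2[OF V]])
    moreover have "?k \<in> rep_hom K Q (obj_map H V) (obj_map F V)"
      by (rule rep_hom_comp[OF H[OF V] h(1) g(1)])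
    ultimately show ?thesis
      unfolding iso_in_rep_category
      by (intro conjI bexI[where x = ?k]) (simp_all add: \<kappa> compose_def car g(2,3) h(2,3))
  qed
  moreover have "\<kappa> W s (mor_map F V W f s x) = mor_map H V W f s (\<kappa> V s x)"
    if V: "fin_dim_rep K Q V" and W: "fin_dim_rep K Q W" and f: "f \<in> rep_hom K Q V W"
      and s: "s \<in> verts Q" and x: "x \<in> carrier (space (obj_map F V) s)" for V W f s x
    using nat1[OF V W f s x] nat2[OF V W f s rep_hom_carrier[OF hom1[OF V] s x]]
      \<kappa>[OF s x] \<kappa>[OF s rep_hom_carrier[OF mor_closed[OF V W f] s x]] by simp
  ultimately show ?thesis
    unfolding naturally_isomorphic_rep_category by blast
qed

end

section \<open>Kernel operators of words and finiteness of the monoid\<close>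

context quiver_over_field
begin

text \<open>The surjection is kept existential: what matters from here on is its kernel, built along
  the word starting from the identity functor.\<close>

lemma quotient_functor_word:
  fixes F :: "'v list \<Rightarrow> (('k, 'v, 'e, 'a) quiver_rep, 'v \<Rightarrow> 'a \<Rightarrow> 'a) endofunctor"
  defines "F \<equiv> \<lambda>ts. foldr (\<lambda>t F. projection_functor K Q t \<circ>\<^sub>F F) ts identity_functor"
  assumes "ts \<in> lists (verts Q)"
  shows "\<exists>p. quotient_functor K Q (F ts) p (\<lambda>V. foldr (extend_at Q V) ts (zero_subrep Q V))"
  using assms(2)
proof (induction ts)
  case Nil
  show ?case
    using quotient_functor_identity by (auto simp: F_def)
next
  case (Cons t ts)
  then obtain p where "quotient_functor K Q (F ts) p (\<lambda>V. foldr (extend_at Q V) ts (zero_subrep Q V))"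
    and t: "t \<in> verts Q" by auto
  from quotient_functor_comp_projection[OF this] show ?case
    by (auto simp: F_def)
qed

text \<open>The condition at t only looks at the heads of arrows out of t; without loops these are
  other vertices, where the first application changed nothing.\<close>

lemma extend_at_idem:
  "extend_at Q V t (extend_at Q V t U) = extend_at Q V t U"
  using no_loops by (fastforce simp: extend_at_def fun_eq_iff)

text \<open>The outer operator overwrites the value at s, and the condition it imposes there does
  not look at s. Without an arrow from t to s the middle operator does not look at s either, so the
  innermost change is forgotten.\<close>

lemma extend_at_absorb:
  assumes "s \<noteq> t" "\<not> t \<rightarrow>\<^bsub>Q\<^esub> s"
  shows "extend_at Q V s (extend_at Q V t (extend_at Q V s U)) = extend_at Q V s (extend_at Q V t U)"
proof -
  have "head Q e \<noteq> s" if "e \<in> arcs Q" "tail Q e = t" for e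
    using that assms(2) in_arcs_imp_in_arcs_ends by metis
  then have t: "extend_at Q V t (extend_at Q V s U) t = extend_at Q V t U t"
    by (auto simp: extend_at_def)
  have ne: "head Q e \<noteq> s" if "e \<in> arcs Q" "tail Q e = s" for e
    using no_loops that by metis
  have eq: "extend_at Q V t (extend_at Q V s U) r = extend_at Q V t U r" if "r \<noteq> s" for r
    using that t by (cases "r = t") (simp_all add: extend_at_def)
  show ?thesis
  proof
    fix r
    show "extend_at Q V s (extend_at Q V t (extend_at Q V s U)) r = extend_at Q V s (extend_at Q V t U) r"
    proof (cases "r = s")
      case True
      then show ?thesis
        unfolding extend_at_def[of Q V s] using eq ne by (auto simp: extend_at_def[of Q V s])
    next
      case False
      then show ?thesis using eq by (simp add: extend_at_def[of Q V s])
    qed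
  qed
qed

end

lemma projection_monoid_finite:
  fixes K :: "('k, 'r) ring_scheme" and Q :: "('v, 'e) pre_digraph"
  assumes "field K" and "fin_digraph Q" and acyc: "\<nexists>p. pre_digraph.cycle Q p"
  shows "finite (carrier (projection_monoid K Q ::
    (('k, 'v, 'e, 'a) quiver_rep, 'v \<Rightarrow> 'a \<Rightarrow> 'a) endofunctor set monoid))"
proof -
  interpret K: field K by fact
  interpret Q: fin_digraph Q by fact
  interpret quiver_over_field K Q
    by unfold_locales (rule Q.no_loop[OF acyc])
  define F :: "'v list \<Rightarrow> (('k, 'v, 'e, 'a) quiver_rep, 'v \<Rightarrow> 'a \<Rightarrow> 'a) endofunctor"
    where "F = (\<lambda>ts. foldr (\<lambda>t F. projection_functor K Q t \<circ>\<^sub>F F) ts identity_functor)"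
  \<comment> \<open>The operators are kept as functions of all representations V and of the initial
    family, so that concatenation of words becomes composition. The kernel itself is the value at
    the zero subrepresentation.\<close>
  define \<phi> where "\<phi> ts = (\<lambda>(V :: ('k, 'v, 'e, 'a) quiver_rep). foldr (extend_at Q V) ts)" for ts
  have "finite (\<phi> ` lists (verts Q))"
  proof (rule finite_image_lists_absorb[where R = "\<lambda>t s. t \<rightarrow>\<^bsub>Q\<^esub> s" and g = "\<lambda>a b V U. a V (b V U)"])
    show "\<phi> (u @ v) = (\<lambda>V U. \<phi> u V (\<phi> v V U))" for u v
      by (simp add: \<phi>_def fun_eq_iff)
    show "\<phi> [s, s] = \<phi> [s]" for s
      by (simp add: \<phi>_def fun_eq_iff extend_at_idem)
    show "\<phi> [s, t, s] = \<phi> [s, t]" if "s \<noteq> t" "\<not> t \<rightarrow>\<^bsub>Q\<^esub> s" for s t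
      by (simp add: \<phi>_def fun_eq_iff extend_at_absorb[OF that])
    show "\<exists>m\<in>Y. \<forall>t\<in>Y. \<not> t \<rightarrow>\<^bsub>Q\<^esub> m" if "Y \<subseteq> verts Q" "Y \<noteq> {}" for Y
      by (rule Q.source_exists[OF acyc that])
  qed simp
  moreover have "projection_class K Q (F u) = projection_class K Q (F v)"
    if u: "u \<in> lists (verts Q)" and v: "v \<in> lists (verts Q)" and eq: "\<phi> u = \<phi> v" for u v
  proof -
    have sub: "projection_class K Q (F u) \<subseteq> projection_class K Q (F v)"
      if u: "u \<in> lists (verts Q)" and v: "v \<in> lists (verts Q)" and eq: "\<phi> u = \<phi> v" for u v
    proof
      fix G assume "G \<in> projection_class K Q (F u)"
      then have G: "G \<in> projection_composites K Q"
        and iso: "naturally_isomorphic (rep_category K Q) (F u) G"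
        by (simp_all add: projection_class_def)
      obtain w where w: "w \<in> lists (verts Q)" "G = F w"
        using G by (auto simp: projection_composites_def F_def)
      obtain p where u': "quotient_functor K Q (F u) p (\<lambda>V. \<phi> u V (zero_subrep Q V))"
        using quotient_functor_word[OF u] by (auto simp: F_def \<phi>_def)
      obtain q where v': "quotient_functor K Q (F v) q (\<lambda>V. \<phi> v V (zero_subrep Q V))"
        using quotient_functor_word[OF v] by (auto simp: F_def \<phi>_def)
      obtain r where w': "quotient_functor K Q (F w) r (\<lambda>V. \<phi> w V (zero_subrep Q V))"
        using quotient_functor_word[OF w(1)] by (auto simp: F_def \<phi>_def)
      \<comment> \<open>Equal operators have equal values at the zero subrepresentation of every V,
        and these are the kernels.\<close>
      have "naturally_isomorphic (rep_category K Q) (F v) (F u)"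
        by (rule quotient_functor.naturally_isomorphic_if_same_kernel[OF v' u']) (simp add: eq)
      then have "naturally_isomorphic (rep_category K Q) (F v) G"
        by (rule quotient_functor.naturally_isomorphic_trans[OF v' _ iso])
          (simp_all add: w(2) quotient_functor.obj_closed[OF u'] quotient_functor.obj_closed[OF w'])
      then show "G \<in> projection_class K Q (F v)"
        using G by (simp add: projection_class_def)
    qed
    show ?thesis using sub[OF u v eq] sub[OF v u eq[symmetric]] by blast
  qed
  ultimately have "finite ((\<lambda>w. projection_class K Q (F w)) ` lists (verts Q))"
    by (rule finite_image_factor)
  moreover have "carrier (projection_monoid K Q)
      = (\<lambda>w. projection_class K Q (F w)) ` lists (verts Q)"
    by (auto simp: projection_monoid_def projection_composites_def F_def)
  ultimately show ?thesis by simp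
qed

theorem corollary3p3:
  fixes K :: "('k, 'r) ring_scheme" and Q :: "('v, 'e) pre_digraph"
  assumes "field K"
    and "fin_digraph Q"
    and "\<nexists>p. pre_digraph.cycle Q p"
  shows "fin_dim_space K (B_algebra K Q) \<and>
    finite (carrier (projection_monoid K Q ::
      (('k, 'v, 'e, 'a) quiver_rep, 'v \<Rightarrow> 'a \<Rightarrow> 'a) endofunctor set monoid))"
  using B_algebra_fin_dim[OF assms] projection_monoid_finite[OF assms] by blast

end
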